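(* Let $H$ be a bipartite graph. The following are equivalent: (i) $H$ is real-norming; (ii) $f\mapsto s_H(f)^{1/e(H)}$ is a norm on $\mathcal{F}_{\mathbb{C}}$; (iii) $H$ is complex-norming.
   Context: $\mathcal{F}_{\mathbb{R}}$, $\mathcal{F}_{\mathbb{C}}$ are the vector spaces of bounded measurable functions $[0,1]^2\to\mathbb{R}$, resp. $\mathbb{C}$; a norm is a seminorm vanishing only on functions that are $0$ a.e. $H$ is finite, nonempty, without isolated vertices, with fixed bipartition $A\cup B$, edges $(u,v)$ with $u\in A$, $v\in B$; $e(H)=|E(H)|$. With variables $x_u$ ($u\in A$), $y_v$ ($v\in B$) in $[0,1]$ and Lebesgue measure: $t_H(f)=\int\prod_{(u,v)\in E(H)}f(x_u,y_v)$; for $\alpha:E(H)\to\{0,1\}$, $t_{H,\alpha}(f)=\int\prod_{e=(u,v)}f(x_u,y_v)^{\alpha(e)}\overline{f(x_u,y_v)}^{1-\alpha(e)}$; and $s_H(f)=\max_\alpha|t_{H,\alpha}(f)|$ over all $\alpha:E(H)\to\{0,1\}$. $H$ is real-norming if $|t_H(\cdot)|^{1/e(H)}$ is a norm on $\mathcal{F}_{\mathbb{R}}$; $H$ is complex-norming if for some $\alpha$, $|t_{H,\alpha}(\cdot)|^{1/e(H)}$ is a norm on $\mathcal{F}_{\mathbb{C}}$. *)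

theory Defs
  imports "HOL-Analysis.Analysis"
begin

locale bipartite_graph =
  fixes A B :: "'v set" and E :: "('v \<times> 'v) set"
  assumes finite_A: "finite A"
    and finite_B: "finite B"
    and disjoint: "A \<inter> B = {}"
    and nonempty: "A \<union> B \<noteq> {}"
    and edges: "E \<subseteq> A \<times> B"
    and no_isolated_A: "\<And>u. u \<in> A \<Longrightarrow> \<exists>v. (u, v) \<in> E"
    and no_isolated_B: "\<And>v. v \<in> B \<Longrightarrow> \<exists>u. (u, v) \<in> E"

abbreviation unit_square :: "(real \<times> real) set" where
  "unit_square \<equiv> {0..1} \<times> {0..1}"

(* Functions on the unit square are represented by functions on the plane; their values outside
   the square are unconstrained and enter none of the definitions below. *)
definition bdd_meas :: "(real \<times> real \<Rightarrow> 'a::real_normed_field) set" where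
  "bdd_meas = {f. f \<in> borel_measurable (lebesgue_on unit_square) \<and> bounded (f ` unit_square)}"

(* The scalars are the values of the functions: the real vector space of real-valued functions
   for 'a = real, the complex vector space of complex-valued functions for 'a = complex. *)
definition is_seminorm :: "((real \<times> real \<Rightarrow> 'a::real_normed_field) \<Rightarrow> real) \<Rightarrow> bool" where
  "is_seminorm N \<longleftrightarrow>
     (\<forall>f\<in>bdd_meas. 0 \<le> N f) \<and>
     (\<forall>c. \<forall>f\<in>bdd_meas. N (\<lambda>z. c * f z) = norm c * N f) \<and>
     (\<forall>f\<in>bdd_meas. \<forall>g\<in>bdd_meas. N (\<lambda>z. f z + g z) \<le> N f + N g)"

definition is_norm :: "((real \<times> real \<Rightarrow> 'a::real_normed_field) \<Rightarrow> real) \<Rightarrow> bool" where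
  "is_norm N \<longleftrightarrow>
     is_seminorm N \<and>
     (\<forall>f\<in>bdd_meas. N f = 0 \<longrightarrow> (AE z in lebesgue_on unit_square. f z = 0))"

(* Lebesgue measure on the cube with one coordinate in [0,1] per vertex. The completion makes
   the integrands below measurable when f is only Lebesgue (not Borel) measurable. *)
definition cube_measure :: "'v set \<Rightarrow> ('v \<Rightarrow> real) measure" where
  "cube_measure V = completion (\<Pi>\<^sub>M w\<in>V. restrict_space lborel {0..1})"

definition t_hom :: "'v set \<Rightarrow> 'v set \<Rightarrow> ('v \<times> 'v) set \<Rightarrow> (real \<times> real \<Rightarrow> real) \<Rightarrow> real" where
  "t_hom A B E f = (\<integral>x. (\<Prod>(u, v)\<in>E. f (x u, x v)) \<partial>cube_measure (A \<union> B))"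

definition t_hom_conj ::
  "'v set \<Rightarrow> 'v set \<Rightarrow> ('v \<times> 'v) set \<Rightarrow> ('v \<times> 'v \<Rightarrow> nat) \<Rightarrow> (real \<times> real \<Rightarrow> complex) \<Rightarrow> complex" where
  "t_hom_conj A B E \<alpha> f =
     (\<integral>x. (\<Prod>(u, v)\<in>E. f (x u, x v) ^ \<alpha> (u, v) * cnj (f (x u, x v)) ^ (1 - \<alpha> (u, v)))
        \<partial>cube_measure (A \<union> B))"

definition s_max ::
  "'v set \<Rightarrow> 'v set \<Rightarrow> ('v \<times> 'v) set \<Rightarrow> (real \<times> real \<Rightarrow> complex) \<Rightarrow> real" where
  "s_max A B E f = Max ((\<lambda>\<alpha>. cmod (t_hom_conj A B E \<alpha> f)) ` (E \<rightarrow>\<^sub>E {0, 1}))"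

definition real_norming :: "'v set \<Rightarrow> 'v set \<Rightarrow> ('v \<times> 'v) set \<Rightarrow> bool" where
  "real_norming A B E \<longleftrightarrow> is_norm (\<lambda>f. \<bar>t_hom A B E f\<bar> powr (1 / real (card E)))"

definition complex_norming :: "'v set \<Rightarrow> 'v set \<Rightarrow> ('v \<times> 'v) set \<Rightarrow> bool" where
  "complex_norming A B E \<longleftrightarrow>
     (\<exists>\<alpha> \<in> E \<rightarrow>\<^sub>E {0, 1}. is_norm (\<lambda>f. cmod (t_hom_conj A B E \<alpha> f) powr (1 / real (card E))))"

end

theory Submission
  imports Defs "HOL-Probability.Probability"
begin

text \<open>
  A norm on complex functions restricts to real functions, where every \<open>t_hom_conj\<close> and \<open>s_max\<close>
  reduce to \<open>t_hom\<close>; so the content is that a real-norming \<open>H\<close> is complex-norming. A measure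
  preserving map \<open>[0,1] \<rightarrow> [0,1]\<^sup>2\<close> provides tensor products \<open>f \<otimes> g\<close> of functions on the unit square
  for which homomorphism densities are multiplicative. Applying the real norm to the real functions
  \<open>\<Sum>\<^sub>e 2 Re (f\<^sub>e \<otimes> ... \<otimes> f\<^sub>e)\<close> (\<open>k\<close> factors) and expanding multilinearly bounds a sum of \<open>k\<close>-th powers
  of numbers, one of which is \<open>t_H((f\<^sub>e))\<close>, uniformly in \<open>k\<close>; hence each of them has modulus at
  most 1. This is a Hoelder inequality with respect to \<open>s_max\<close>, and it makes the \<open>e(H)\<close>-th root of
  \<open>s_max\<close> a norm. Hoelder's inequality also shows that finitely many functions have a common
  maximising choice of conjugates: a choice maximising \<open>f \<otimes> g\<close> or \<open>f \<otimes> cnj g\<close> maximises both \<open>f\<close>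
  and \<open>g\<close>. As there are only finitely many choices, one of them is maximising for all functions.
\<close>

section \<open>A Borel encoding of pairs\<close>

text \<open>
  A point \<open>z\<close> is encoded by the real number whose digits in base 3 are the truth values
  \<open>rat_enum n < fst z\<close> and \<open>rat_enum n < snd z\<close>. As only the digits 0 and 1 occur, they can be read
  off greedily, which makes decoding a Borel function.
\<close>

primrec ternary_rem :: "real \<Rightarrow> nat \<Rightarrow> real" where
  "ternary_rem w 0 = w"
| "ternary_rem w (Suc n) = 3 * (ternary_rem w n - of_bool (1 \<le> ternary_rem w n))"

lemma borel_measurable_ternary_rem [measurable]:
  "(\<lambda>w. ternary_rem w n) \<in> borel_measurable borel"
  by (induction n) (simp_all, measurable)

lemma summable_ternary: "summable (\<lambda>k. of_bool (c k) / 3 ^ k :: real)"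
proof (rule summable_comparison_test')
  show "summable (\<lambda>k. (1 / 3) ^ k :: real)"
    by (simp add: summable_geometric)
qed (simp add: power_divide)

text \<open>After \<open>n\<close> steps the remainder is a tail of the series. Digits 0 and 1 keep
  every tail in [0, 3/2], so at most 1/2 remains after the leading digit and comparison with 1 reads
  that digit correctly.\<close>

lemma ternary_rem_suminf:
  "ternary_rem (\<Sum>k. of_bool (c k) / 3 ^ k) n = (\<Sum>k. of_bool (c (n + k)) / 3 ^ k)
   \<and> (1 \<le> ternary_rem (\<Sum>k. of_bool (c k) / 3 ^ k) n \<longleftrightarrow> c n)"
proof (induction n)
  have tail: "(\<Sum>k. of_bool (c k) / 3 ^ k) = of_bool (c 0) + (\<Sum>k. of_bool (c (Suc k)) / 3 ^ k) / (3::real)" for c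
  proof -
    have "(\<Sum>k. of_bool (c k) / 3 ^ k :: real) = of_bool (c 0) / 3 ^ 0 + (\<Sum>k. of_bool (c (Suc k)) / 3 ^ Suc k)"
      using suminf_split_head[OF summable_ternary[of c]] by simp
    also have "(\<Sum>k. of_bool (c (Suc k)) / 3 ^ Suc k) = (\<Sum>k. (of_bool (c (Suc k)) / 3 ^ k) / (3::real))"
      by (simp add: field_simps)
    also have "\<dots> = (\<Sum>k. of_bool (c (Suc k)) / 3 ^ k) / 3"
      by (rule suminf_divide[OF summable_ternary])
    finally show ?thesis by simp
  qed
  have le: "0 \<le> (\<Sum>k. of_bool (c k) / 3 ^ k :: real)" "(\<Sum>k. of_bool (c k) / 3 ^ k :: real) \<le> 3 / 2" for c
  proof -
    show "0 \<le> (\<Sum>k. of_bool (c k) / 3 ^ k :: real)"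
      by (intro suminf_nonneg summable_ternary) simp
    have "(\<Sum>k. of_bool (c k) / 3 ^ k :: real) \<le> (\<Sum>k. (1 / 3) ^ k)"
      by (intro suminf_le summable_ternary) (auto simp: summable_geometric simp flip: power_one_over)
    also have "\<dots> = 3 / 2" by (subst suminf_geometric) auto
    finally show "(\<Sum>k. of_bool (c k) / 3 ^ k :: real) \<le> 3 / 2" .
  qed
  have digit: "1 \<le> (\<Sum>k. of_bool (c k) / 3 ^ k :: real) \<longleftrightarrow> c 0" for c
    using le[of "\<lambda>k. c (Suc k)"] by (subst tail) (cases "c 0"; simp)
  {
    case 0
    show ?case using digit[of c] by simp
  next
    case (Suc n)
    let ?t = "\<lambda>n. \<Sum>k. of_bool (c (n + k)) / (3::real) ^ k"
    have "ternary_rem (?t 0) (Suc n) = 3 * (?t n - of_bool (c n))"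
      using Suc digit[of "\<lambda>k. c (n + k)"] by simp
    also have "\<dots> = ?t (Suc n)"
      by (subst (1) tail) simp
    finally have eq: "ternary_rem (?t 0) (Suc n) = ?t (Suc n)" .
    show ?case using eq digit[of "\<lambda>k. c (Suc n + k)"] by simp
  }
qed

definition rat_enum :: "nat \<Rightarrow> real" where
  "rat_enum n = of_rat (from_nat n)"

text \<open>Even positions hold the cut of the first coordinate, odd positions that of the second;
  \<open>decode i\<close> accordingly reads the positions \<open>2 * n + i\<close>.\<close>

definition cut_digit :: "real \<times> real \<Rightarrow> nat \<Rightarrow> bool" where
  "cut_digit z k = (rat_enum (k div 2) < (if even k then fst z else snd z))"

definition encode_pair :: "real \<times> real \<Rightarrow> real" where
  "encode_pair z = (\<Sum>k. of_bool (cut_digit z k) / 3 ^ k)"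

text \<open>The coordinate is recovered as the supremum of the rationals below it. Clamping, with 0
  for an unset digit, keeps the value in [0,1] for every \<open>w\<close>, code or not.\<close>

definition decode :: "nat \<Rightarrow> real \<Rightarrow> real" where
  "decode i w = (SUP n. if 1 \<le> ternary_rem w (2 * n + i) then max 0 (min 1 (rat_enum n)) else 0)"

lemma borel_measurable_encode_pair [measurable]: "encode_pair \<in> borel_measurable borel"
proof -
  have [measurable]: "(fst :: real \<times> real \<Rightarrow> real) \<in> borel_measurable borel"
    "(snd :: real \<times> real \<Rightarrow> real) \<in> borel_measurable borel"
    by (auto intro!: borel_measurable_continuous_onI continuous_intros)
  have "(\<lambda>z. of_bool (cut_digit z k) / 3 ^ k :: real) \<in> borel_measurable borel" for k
    unfolding cut_digit_def by (cases "even k"; simp)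
  then show ?thesis unfolding encode_pair_def by (rule borel_measurable_suminf)
qed

lemma decode_bdd: "bdd_above (range (\<lambda>n. if 1 \<le> ternary_rem w (2 * n + i) then max 0 (min 1 (rat_enum n)) else 0))"
  by (rule bdd_aboveI[where M = 1]) auto

lemma borel_measurable_decode [measurable]: "decode i \<in> borel_measurable borel"
  unfolding decode_def by (intro borel_measurable_cSUP decode_bdd) (auto, measurable)

lemma decode_in: "decode i w \<in> {0..1}"
proof -
  have "decode i w \<le> 1" unfolding decode_def by (rule cSUP_least) auto
  moreover have "0 \<le> decode i w" unfolding decode_def
    by (rule cSUP_upper2[OF decode_bdd, of 0]) auto
  ultimately show ?thesis by simp
qed

lemma decode_encode_pair:
  assumes "z \<in> unit_square" "i < 2"
  shows "decode i (encode_pair z) = (if i = 0 then fst z else snd z)"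
proof -
  define x where "x = (if i = 0 then fst z else snd z)"
  have x: "0 \<le> x" "x \<le> 1" using assms by (auto simp: x_def)
  have dig: "1 \<le> ternary_rem (encode_pair z) (2 * n + i) \<longleftrightarrow> rat_enum n < x" for n
    using ternary_rem_suminf[of "cut_digit z" "2 * n + i"] assms(2)
    by (auto simp: encode_pair_def cut_digit_def x_def less_2_cases_iff)
  have "decode i (encode_pair z) = (SUP n. if rat_enum n < x then max 0 (min 1 (rat_enum n)) else 0)"
    unfolding decode_def dig ..
  also have "\<dots> = x"
  proof (rule cSup_eq)
    fix y assume "y \<in> range (\<lambda>n. if rat_enum n < x then max 0 (min 1 (rat_enum n)) else 0)"
    then show "y \<le> x" using x by auto
  next
    fix y assume y: "\<And>v. v \<in> range (\<lambda>n. if rat_enum n < x then max 0 (min 1 (rat_enum n)) else 0) \<Longrightarrow> v \<le> y"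
    show "x \<le> y"
    proof (rule ccontr)
      assume "\<not> x \<le> y"
      then obtain r where r: "y < of_rat r" "of_rat r < x"
        using of_rat_dense[of y x] by auto
      \<comment> \<open>The clamp does no harm: \<open>r\<close> is below 1, and raising it to 0
        keeps it above \<open>y\<close>.\<close>
      have "of_rat r = rat_enum (to_nat r)" by (simp add: rat_enum_def)
      with r x y[OF rangeI[of _ "to_nat r"]] show False by auto
    qed
  qed
  finally show ?thesis by (simp add: x_def)
qed

section \<open>A measure preserving map onto the square\<close>

abbreviation uniform01 :: "real measure" where
  "uniform01 \<equiv> restrict_space lborel {0..1}"

lemma space_uniform01 [simp]: "space uniform01 = {0..1}"
  by (simp add: space_restrict_space)

lemma prob_space_uniform01: "prob_space uniform01"
  by (rule prob_spaceI) (simp add: emeasure_restrict_space space_restrict_space)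

lemma measurable_uniform01I:
  "f \<in> borel_measurable M \<Longrightarrow> (\<And>x. x \<in> space M \<Longrightarrow> f x \<in> {0..1}) \<Longrightarrow> f \<in> M \<rightarrow>\<^sub>M uniform01"
  by (intro measurable_restrict_space2) auto

lemma id_measurable_uniform01 [measurable]: "(\<lambda>x. x) \<in> uniform01 \<rightarrow>\<^sub>M borel"
  by (intro measurable_restrict_space1) simp

lemma uniform01_pair_borel: "(\<lambda>z. z) \<in> uniform01 \<Otimes>\<^sub>M uniform01 \<rightarrow>\<^sub>M borel"
proof -
  have "(\<lambda>z. (fst z, snd z)) \<in> uniform01 \<Otimes>\<^sub>M uniform01 \<rightarrow>\<^sub>M borel \<Otimes>\<^sub>M borel"
    by (intro measurable_Pair measurable_compose[OF measurable_fst id_measurable_uniform01]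
        measurable_compose[OF measurable_snd id_measurable_uniform01])
  then show ?thesis by (simp add: borel_prod)
qed

text \<open>
  The quantile function of the law of the code of a uniform point, followed by decoding.
\<close>

lemma ex_measure_preserving_pair:
  obtains p q :: "real \<Rightarrow> real" where
    "p \<in> borel_measurable borel" "q \<in> borel_measurable borel"
    "range p \<subseteq> {0..1}" "range q \<subseteq> {0..1}"
    "distr uniform01 (uniform01 \<Otimes>\<^sub>M uniform01) (\<lambda>x. (p x, q x)) = uniform01 \<Otimes>\<^sub>M uniform01"
proof -
  interpret U: prob_space uniform01 by (rule prob_space_uniform01)
  interpret UU: pair_prob_space uniform01 uniform01 ..
  let ?U2 = "uniform01 \<Otimes>\<^sub>M uniform01"
  have enc [measurable]: "encode_pair \<in> borel_measurable ?U2"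
    by (rule measurable_compose[OF uniform01_pair_borel borel_measurable_encode_pair])
  define \<mu> where "\<mu> = distr ?U2 borel encode_pair"
  interpret M: real_distribution \<mu>
    unfolding \<mu>_def by (rule UU.real_distribution_distr) (rule enc)
  interpret M: cdf_distribution \<mu> by unfold_locales
  \<comment> \<open>The quantile function \<open>M.I\<close> is taken on the open interval; the
    endpoints, a null set, receive the default value 0.\<close>
  define \<phi> where "\<phi> x = (if x \<in> {0<..<1} then M.I x else 0)" for x
  have \<phi> [measurable]: "\<phi> \<in> borel_measurable borel"
  proof -
    have "{x. 0 < x \<and> x < 1} = {0<..<1::real}" by auto
    then show ?thesis
      unfolding \<phi>_def using M.measurable_CI
      by (subst measurable_If_restrict_space_iff) auto
  qed
  have distr_\<phi>: "distr uniform01 borel \<phi> = \<mu>"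
  proof (rule measure_eqI)
    fix A assume "A \<in> sets (distr uniform01 borel \<phi>)"
    then have A [measurable]: "A \<in> sets borel" by simp
    let ?R = "restrict_space lborel {0<..<1::real}"
    have "emeasure (distr uniform01 borel \<phi>) A = emeasure lborel ({0..1} \<inter> \<phi> -` A)"
      by (subst emeasure_distr)
         (auto simp: emeasure_restrict_space Int_commute intro!: measurable_restrict_space1)
    also have "\<dots> = emeasure lborel ({0<..<1} \<inter> \<phi> -` A)"
    proof (rule emeasure_eq_AE)
      have "AE x in lborel. x \<notin> {0, 1::real}"
        by (rule AE_not_in) (simp add: finite_imp_null_set_lborel)
      then show "AE x in lborel. x \<in> {0..1} \<inter> \<phi> -` A \<longleftrightarrow> x \<in> {0<..<1} \<inter> \<phi> -` A"
        by eventually_elim auto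
    qed (use measurable_sets_borel[OF \<phi> A] in auto)
    also have "{0<..<1} \<inter> \<phi> -` A = M.I -` A \<inter> space ?R"
      by (auto simp: \<phi>_def space_restrict_space)
    also have "emeasure lborel \<dots> = emeasure ?R (M.I -` A \<inter> space ?R)"
      by (subst emeasure_restrict_space) (auto simp: space_restrict_space)
    also have "\<dots> = emeasure (distr ?R borel M.I) A"
      by (rule emeasure_distr[symmetric]) (use M.measurable_CI in \<open>auto cong: measurable_cong_sets sets_restrict_space_cong\<close>)
    also have "\<dots> = emeasure \<mu> A" by (simp only: M.distr_I_eq_M)
    finally show "emeasure (distr uniform01 borel \<phi>) A = emeasure \<mu> A" .
  qed (simp add: \<mu>_def)
  define d where "d w = (decode 0 w, decode 1 w)" for w
  have d: "d \<in> borel \<rightarrow>\<^sub>M ?U2"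
    unfolding d_def
    by (intro measurable_Pair measurable_uniform01I decode_in) measurable
  have "distr uniform01 ?U2 (d \<circ> \<phi>) = distr \<mu> ?U2 d"
    unfolding distr_\<phi>[symmetric] by (rule distr_distr[symmetric]) (use d in \<open>auto intro: measurable_restrict_space1\<close>)
  also have "\<dots> = distr ?U2 ?U2 (d \<circ> encode_pair)"
    unfolding \<mu>_def by (rule distr_distr[OF d enc])
  also have "\<dots> = distr ?U2 ?U2 (\<lambda>z. z)"
    by (rule distr_cong) (auto simp: d_def decode_encode_pair space_pair_measure)
  also have "\<dots> = ?U2" by (rule distr_id2) simp
  finally show thesis
    by (intro that[of "decode 0 \<circ> \<phi>" "decode 1 \<circ> \<phi>"] measurable_comp[OF \<phi>])
       (auto simp: d_def comp_def decode_in[unfolded atLeastAtMost_iff])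
qed

section \<open>Homomorphism densities of families of functions\<close>

text \<open>Borel functions stay measurable under composition with Borel maps of the coordinates,
  which the tensor products rely on. Lebesgue measurable functions return at the end through almost
  everywhere equal Borel representatives.\<close>

definition bdd_borel :: "(real \<times> real \<Rightarrow> complex) set" where
  "bdd_borel = {f. f \<in> borel_measurable borel \<and> bounded (range f)}"

lemma bdd_borelD: "f \<in> bdd_borel \<Longrightarrow> f \<in> borel_measurable borel"
  by (simp add: bdd_borel_def)

lemma bdd_borel_bound:
  assumes "f \<in> bdd_borel"
  obtains b where "\<And>z. cmod (f z) \<le> b"
  using assms by (auto simp: bdd_borel_def bounded_iff)

lemma bdd_borelI:
  "f \<in> borel_measurable borel \<Longrightarrow> (\<And>z. cmod (f z) \<le> b) \<Longrightarrow> f \<in> bdd_borel"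
  by (auto simp: bdd_borel_def bounded_iff)

lemma bdd_borel_const: "(\<lambda>_. c) \<in> bdd_borel"
  by (rule bdd_borelI[where b = "cmod c"]) auto

lemma bdd_borel_add: "f \<in> bdd_borel \<Longrightarrow> g \<in> bdd_borel \<Longrightarrow> (\<lambda>z. f z + g z) \<in> bdd_borel"
  using bounded_plus_comp[of f UNIV g] by (auto simp: bdd_borel_def)

lemma bdd_borel_mult: "f \<in> bdd_borel \<Longrightarrow> g \<in> bdd_borel \<Longrightarrow> (\<lambda>z. f z * g z) \<in> bdd_borel"
proof -
  assume f: "f \<in> bdd_borel" and g: "g \<in> bdd_borel"
  obtain a b where "\<And>z. cmod (f z) \<le> a" "\<And>z. cmod (g z) \<le> b"
    using bdd_borel_bound[OF f] bdd_borel_bound[OF g] by metis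
  then have "cmod (f z * g z) \<le> a * b" for z
    unfolding norm_mult by (intro mult_mono) (auto intro: order_trans[OF norm_ge_zero])
  then show ?thesis
    by (rule bdd_borelI[OF borel_measurable_times[OF bdd_borelD[OF f] bdd_borelD[OF g]]])
qed

lemma bdd_borel_sum: "(\<And>j. j \<in> J \<Longrightarrow> f j \<in> bdd_borel) \<Longrightarrow> (\<lambda>z. \<Sum>j\<in>J. f j z) \<in> bdd_borel"
  by (induction J rule: infinite_finite_induct) (auto simp: bdd_borel_const bdd_borel_add)

lemma bdd_borel_cnj: "f \<in> bdd_borel \<Longrightarrow> (\<lambda>z. cnj (f z)) \<in> bdd_borel"
proof -
  assume f: "f \<in> bdd_borel"
  have "cnj \<in> borel_measurable borel"
    by (intro borel_measurable_continuous_onI continuous_intros)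
  from measurable_compose[OF bdd_borelD[OF f] this] bdd_borel_bound[OF f]
  show ?thesis by (metis bdd_borelI complex_mod_cnj)
qed

section \<open>Multilinear densities with a separate function on every edge\<close>

context bipartite_graph
begin

abbreviation cube :: "('v \<Rightarrow> real) measure" where
  "cube \<equiv> \<Pi>\<^sub>M w\<in>A \<union> B. uniform01"

definition hom :: "('v \<times> 'v \<Rightarrow> real \<times> real \<Rightarrow> complex) \<Rightarrow> complex" where
  "hom F = (\<integral>x. (\<Prod>e\<in>E. F e (x (fst e), x (snd e))) \<partial>cube)"

lemma finite_vertices: "finite (A \<union> B)"
  using finite_A finite_B by simp

lemma finite_edges: "finite E"
  using edges finite_A finite_B by (meson finite_SigmaI finite_subset)

lemma edge_verts: "e \<in> E \<Longrightarrow> fst e \<in> A \<union> B \<and> snd e \<in> A \<union> B \<and> fst e \<noteq> snd e"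
  using edges disjoint by fastforce

lemma edges_nonempty: "E \<noteq> {}"
  using nonempty no_isolated_A no_isolated_B by fast

lemma card_edges_pos: "0 < card E"
  using finite_edges edges_nonempty by (simp add: card_gt_0_iff)

sublocale cube: product_prob_space "\<lambda>_. uniform01" "A \<union> B"
  by (rule product_prob_spaceI) (rule prob_space_uniform01)

lemma edge_projection_measurable:
  assumes "e \<in> E"
  shows "(\<lambda>x. (x (fst e), x (snd e))) \<in> cube \<rightarrow>\<^sub>M uniform01 \<Otimes>\<^sub>M uniform01"
  using edge_verts[OF assms] by (intro measurable_Pair measurable_component_singleton) auto

lemma measurable_edge_factor:
  assumes "e \<in> E" "f \<in> borel_measurable borel"
  shows "(\<lambda>x. f (x (fst e), x (snd e))) \<in> borel_measurable cube"
  using measurable_compose[OF edge_projection_measurable[OF assms(1)]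
      measurable_compose[OF uniform01_pair_borel assms(2)]] .

lemma measurable_integrand:
  assumes "\<And>e. e \<in> E \<Longrightarrow> F e \<in> borel_measurable borel"
  shows "(\<lambda>x. \<Prod>e\<in>E. F e (x (fst e), x (snd e)) :: complex) \<in> borel_measurable cube"
  using assms by (intro borel_measurable_prod measurable_edge_factor)

lemma integrable_integrand:
  assumes "\<And>e. e \<in> E \<Longrightarrow> F e \<in> bdd_borel"
  shows "integrable cube (\<lambda>x. \<Prod>e\<in>E. F e (x (fst e), x (snd e)))"
proof -
  have "\<exists>b. \<forall>z. cmod (F e z) \<le> b" if "e \<in> E" for e
    using bdd_borel_bound[OF assms[OF that]] by metis
  then obtain b where b: "\<And>e z. e \<in> E \<Longrightarrow> cmod (F e z) \<le> b e" by metis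
  have "cmod (\<Prod>e\<in>E. F e (x (fst e), x (snd e))) \<le> (\<Prod>e\<in>E. b e)" for x
    unfolding prod_norm[symmetric] by (rule prod_mono) (auto intro: b)
  then show ?thesis
    by (intro cube.P.integrable_const_bound AE_I2 measurable_integrand bdd_borelD assms)
qed

lemma hom_cong: "(\<And>e z. e \<in> E \<Longrightarrow> F e z = G e z) \<Longrightarrow> hom F = hom G"
  by (simp add: hom_def cong: prod.cong)

lemma hom_one: "hom (\<lambda>_ _. 1) = 1"
  by (simp add: hom_def cube.P.prob_space)

lemma hom_scale: "hom (\<lambda>e z. c e * F e z) = (\<Prod>e\<in>E. c e) * hom F"
  by (simp add: hom_def prod.distrib)

lemma hom_cnj: "hom (\<lambda>e z. cnj (F e z)) = cnj (hom F)"
  unfolding hom_def cnj_prod[symmetric] by (rule Bochner_Integration.integral_cnj)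

text \<open>Distributing the product of sums gives one term for each \<open>\<phi>\<close> choosing
  a summand at every edge; boundedness makes each term integrable.\<close>

lemma hom_sum:
  assumes "\<And>e. e \<in> E \<Longrightarrow> finite (J e)"
    and "\<And>e j. e \<in> E \<Longrightarrow> j \<in> J e \<Longrightarrow> F e j \<in> bdd_borel"
  shows "hom (\<lambda>e z. \<Sum>j\<in>J e. F e j z) = (\<Sum>\<phi>\<in>PiE E J. hom (\<lambda>e. F e (\<phi> e)))"
proof -
  have "hom (\<lambda>e z. \<Sum>j\<in>J e. F e j z)
      = (\<integral>x. (\<Sum>\<phi>\<in>PiE E J. \<Prod>e\<in>E. F e (\<phi> e) (x (fst e), x (snd e))) \<partial>cube)"
    unfolding hom_def by (subst prod_sum_PiE) (use finite_edges assms in auto)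
  also have "\<dots> = (\<Sum>\<phi>\<in>PiE E J. hom (\<lambda>e. F e (\<phi> e)))"
    unfolding hom_def
    by (intro Bochner_Integration.integral_sum integrable_integrand assms) (auto dest: PiE_mem)
  finally show ?thesis .
qed

text \<open>The endpoints of an edge are distinct vertices, so their coordinates are independent and
  uniform. This transports null sets of the square to null sets of the cube.\<close>

lemma distr_edge_projection:
  assumes "e \<in> E"
  shows "distr cube (uniform01 \<Otimes>\<^sub>M uniform01) (\<lambda>x. (x (fst e), x (snd e))) = uniform01 \<Otimes>\<^sub>M uniform01"
proof (rule pair_measure_eqI[symmetric])
  show "sigma_finite_measure uniform01" "sigma_finite_measure uniform01" by unfold_locales
  fix X Y :: "real set" assume X: "X \<in> sets uniform01" and Y: "Y \<in> sets uniform01"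
  let ?Z = "\<lambda>w. if w = fst e then X else Y"
  note e = edge_verts[OF assms]
  have "emeasure (distr cube (uniform01 \<Otimes>\<^sub>M uniform01) (\<lambda>x. (x (fst e), x (snd e)))) (X \<times> Y)
      = emeasure cube {x \<in> space cube. \<forall>w\<in>{fst e, snd e}. x w \<in> ?Z w}"
    using X Y e by (subst emeasure_distr[OF edge_projection_measurable[OF assms]])
      (auto intro!: arg_cong[where f = "emeasure cube"])
  also have "\<dots> = (\<Prod>w\<in>{fst e, snd e}. emeasure uniform01 (?Z w))"
    using X Y e by (intro cube.emeasure_PiM_Collect) auto
  also have "\<dots> = emeasure uniform01 X * emeasure uniform01 Y"
    using e by auto
  finally show "emeasure uniform01 X * emeasure uniform01 Y
      = emeasure (distr cube (uniform01 \<Otimes>\<^sub>M uniform01) (\<lambda>x. (x (fst e), x (snd e)))) (X \<times> Y)" ..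
qed simp

end

section \<open>Tensor products\<close>

locale paired_graph = bipartite_graph A B E
  for A B :: "'v set" and E :: "('v \<times> 'v) set" +
  fixes p q :: "real \<Rightarrow> real"
  assumes p_measurable: "p \<in> borel_measurable borel"
    and q_measurable: "q \<in> borel_measurable borel"
    and p_in: "\<And>x. p x \<in> {0..1}"
    and q_in: "\<And>x. q x \<in> {0..1}"
    and distr_pair: "distr uniform01 (uniform01 \<Otimes>\<^sub>M uniform01) (\<lambda>x. (p x, q x)) = uniform01 \<Otimes>\<^sub>M uniform01"
begin

text \<open>The pair \<open>(p x, q x)\<close> turns one uniform variable into two independent ones.
  Thus this is the product of \<open>f\<close> and \<open>g\<close> in separate variables, brought
  back to a function on the plane.\<close>

definition tens :: "(real \<times> real \<Rightarrow> complex) \<Rightarrow> (real \<times> real \<Rightarrow> complex) \<Rightarrow> real \<times> real \<Rightarrow> complex" where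
  "tens f g z = f (p (fst z), p (snd z)) * g (q (fst z), q (snd z))"

lemma bdd_borel_compose:
  assumes "f \<in> bdd_borel" "r \<in> borel_measurable borel"
  shows "(\<lambda>z. f (r (fst z), r (snd z))) \<in> bdd_borel"
proof -
  have "(\<lambda>z. (r (fst z), r (snd z))) \<in> borel \<Otimes>\<^sub>M borel \<rightarrow>\<^sub>M borel \<Otimes>\<^sub>M borel"
    using assms(2) by measurable
  then have "(\<lambda>z. (r (fst z), r (snd z))) \<in> borel_measurable borel"
    unfolding borel_prod .
  from measurable_compose[OF this bdd_borelD[OF assms(1)]] bdd_borel_bound[OF assms(1)]
  show ?thesis by (metis (mono_tags, lifting) bdd_borelI)
qed

lemma bdd_borel_tens: "f \<in> bdd_borel \<Longrightarrow> g \<in> bdd_borel \<Longrightarrow> tens f g \<in> bdd_borel"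
  using bdd_borel_mult[OF bdd_borel_compose[OF _ p_measurable] bdd_borel_compose[OF _ q_measurable], of f g]
  by (simp add: tens_def[abs_def])

lemma pq_measurable [measurable]: "p \<in> uniform01 \<rightarrow>\<^sub>M uniform01" "q \<in> uniform01 \<rightarrow>\<^sub>M uniform01"
  using p_measurable q_measurable p_in q_in
  by (auto intro!: measurable_uniform01I measurable_restrict_space1)

lemma emeasure_pair_preimage:
  assumes X: "X \<in> sets uniform01" and Y: "Y \<in> sets uniform01"
  shows "emeasure uniform01 {x \<in> {0..1}. p x \<in> X \<and> q x \<in> Y} = emeasure uniform01 X * emeasure uniform01 Y"
proof -
  have "emeasure uniform01 X * emeasure uniform01 Y
      = emeasure (distr uniform01 (uniform01 \<Otimes>\<^sub>M uniform01) (\<lambda>x. (p x, q x))) (X \<times> Y)"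
    unfolding distr_pair by (rule cube.M.emeasure_pair_measure_Times[OF X Y, symmetric])
  also have "\<dots> = emeasure uniform01 {x \<in> {0..1}. p x \<in> X \<and> q x \<in> Y}"
    using X Y by (subst emeasure_distr) (auto intro!: arg_cong[where f = "emeasure uniform01"])
  finally show ?thesis ..
qed

text \<open>Marginal case of \<open>emeasure_pair_preimage\<close>: the other set is the whole
  interval.\<close>

lemma emeasure_preimage:
  assumes "r = p \<or> r = q" and X: "X \<in> sets uniform01"
  shows "emeasure uniform01 {x \<in> {0..1}. r x \<in> X} = emeasure uniform01 X"
proof -
  have top: "{0..1} \<in> sets uniform01" "emeasure uniform01 {0..1} = 1"
    using cube.M.emeasure_space_1 sets.top[of uniform01] by simp_all
  show ?thesis
    using emeasure_pair_preimage[OF X top(1)] emeasure_pair_preimage[OF top(1) X] assms(1) p_in q_in top(2)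
    by auto
qed

lemma measurable_component_compose:
  assumes "w \<in> A \<union> B" "r \<in> uniform01 \<rightarrow>\<^sub>M uniform01"
  shows "(\<lambda>x. r (x w)) \<in> cube \<rightarrow>\<^sub>M uniform01"
  using measurable_component_singleton[OF assms(1), of "\<lambda>_. uniform01"] assms(2)
  by (rule measurable_compose)

text \<open>The preimage of a box is a box with sides of unchanged measure, and boxes determine the
  finite product measure.\<close>

lemma distr_cube_map:
  assumes r: "r = p \<or> r = q"
  shows "distr cube cube (\<lambda>x. \<lambda>w\<in>A \<union> B. r (x w)) = cube"
proof (rule cube.PiM_eqI)
  have rm [measurable]: "r \<in> uniform01 \<rightarrow>\<^sub>M uniform01" using r pq_measurable by auto
  fix Z :: "'v \<Rightarrow> real set" assume Z: "\<And>w. w \<in> A \<union> B \<Longrightarrow> Z w \<in> sets uniform01"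
  have Z': "{t \<in> {0..1}. r t \<in> Z w} \<in> sets uniform01" if "w \<in> A \<union> B" for w
    using measurable_sets[OF rm Z[OF that]] by (simp add: vimage_def Int_def conj_commute)
  have "emeasure (distr cube cube (\<lambda>x. \<lambda>w\<in>A \<union> B. r (x w))) (Pi\<^sub>E (A \<union> B) Z)
      = emeasure cube (Pi\<^sub>E (A \<union> B) (\<lambda>w. {t \<in> {0..1}. r t \<in> Z w}))"
    using Z finite_vertices
    by (subst emeasure_distr)
      (auto intro!: arg_cong[where f = "emeasure cube"] measurable_restrict sets_PiM_I_finite
        measurable_component_compose rm simp: space_PiM PiE_iff)
  also have "\<dots> = (\<Prod>w\<in>A \<union> B. emeasure uniform01 {t \<in> {0..1}. r t \<in> Z w})"
    by (rule cube.emeasure_PiM[OF finite_vertices Z'])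
  also have "\<dots> = (\<Prod>w\<in>A \<union> B. emeasure uniform01 (Z w))"
    by (intro prod.cong refl emeasure_preimage r Z)
  finally show "emeasure (distr cube cube (\<lambda>x. \<lambda>w\<in>A \<union> B. r (x w))) (Pi\<^sub>E (A \<union> B) Z)
      = (\<Prod>w\<in>A \<union> B. emeasure uniform01 (Z w))" .
qed (use finite_vertices in simp_all)

lemma hom_compose:
  assumes r: "r = p \<or> r = q" and F: "\<And>e. e \<in> E \<Longrightarrow> F e \<in> bdd_borel"
  shows "(\<integral>x. (\<Prod>e\<in>E. F e (r (x (fst e)), r (x (snd e)))) \<partial>cube) = hom F"
proof -
  have rm: "r \<in> uniform01 \<rightarrow>\<^sub>M uniform01" using r pq_measurable by auto
  have "hom F = (\<integral>x. (\<Prod>e\<in>E. F e (x (fst e), x (snd e))) \<partial>distr cube cube (\<lambda>x. \<lambda>w\<in>A \<union> B. r (x w)))"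
    unfolding hom_def distr_cube_map[OF r] ..
  also have "\<dots> = (\<integral>x. (\<Prod>e\<in>E. F e (r (x (fst e)), r (x (snd e)))) \<partial>cube)"
  proof (subst integral_distr)
    show "(\<lambda>x. \<lambda>w\<in>A \<union> B. r (x w)) \<in> cube \<rightarrow>\<^sub>M cube"
      by (intro measurable_restrict measurable_component_compose rm)
  qed (use F edge_verts in \<open>auto intro!: measurable_integrand bdd_borelD Bochner_Integration.integral_cong prod.cong\<close>)
  finally show ?thesis ..
qed

text \<open>Doubled variables: \<open>(True, w)\<close> and \<open>(False, w)\<close> index the two
  halves \<open>p (x w)\<close> and \<open>q (x w)\<close> of the variable at
  \<open>w\<close>.\<close>

definition coord :: "bool \<times> 'v \<Rightarrow> ('v \<Rightarrow> real) \<Rightarrow> real" where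
  "coord i x = (if fst i then p else q) (x (snd i))"

lemma coord_measurable: "snd i \<in> A \<union> B \<Longrightarrow> coord i \<in> cube \<rightarrow>\<^sub>M uniform01"
  using measurable_component_compose[OF _ pq_measurable(1)] measurable_component_compose[OF _ pq_measurable(2)]
  by (cases "fst i") (simp_all add: coord_def[abs_def])

lemma distr_coord:
  assumes "snd i \<in> A \<union> B"
  shows "distr cube uniform01 (coord i) = uniform01"
proof -
  let ?r = "if fst i then p else q"
  have "distr uniform01 uniform01 ?r = uniform01"
  proof (rule measure_eqI)
    fix X assume "X \<in> sets (distr uniform01 uniform01 ?r)"
    then have X: "X \<in> sets uniform01" by simp
    have "emeasure (distr uniform01 uniform01 ?r) X = emeasure uniform01 {x \<in> {0..1}. ?r x \<in> X}"
      using X by (subst emeasure_distr) (auto intro!: arg_cong[where f = "emeasure uniform01"])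
    then show "emeasure (distr uniform01 uniform01 ?r) X = emeasure uniform01 X"
      using emeasure_preimage[of ?r, OF _ X] by simp
  qed simp
  moreover have "distr cube uniform01 (coord i) = distr (distr cube uniform01 (\<lambda>x. x (snd i))) uniform01 ?r"
    using assms pq_measurable
    by (subst distr_distr) (auto simp: coord_def[abs_def] comp_def)
  ultimately show ?thesis
    using cube.PiM_component[OF assms] by simp
qed

text \<open>A box in the doubled variables pulls back to a box in the cube, and by
  \<open>emeasure_pair_preimage\<close> each of its sides has the product of two measures. Hence the
  joint law is the product of the marginals, which characterises independence.\<close>

lemma indep_coord: "cube.P.indep_vars (\<lambda>_. uniform01) coord (UNIV \<times> (A \<union> B))"
proof -
  let ?I = "(UNIV :: bool set) \<times> (A \<union> B)"
  have fin: "finite ?I" using finite_vertices by simp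
  interpret I: product_prob_space "\<lambda>_::bool \<times> 'v. uniform01" ?I
    by (rule product_prob_spaceI) (rule prob_space_uniform01)
  have "distr cube (\<Pi>\<^sub>M i\<in>?I. uniform01) (\<lambda>x. \<lambda>i\<in>?I. coord i x) = (\<Pi>\<^sub>M i\<in>?I. uniform01)"
  proof (rule I.PiM_eqI[OF fin])
    fix Z :: "bool \<times> 'v \<Rightarrow> real set" assume Z: "\<And>i. i \<in> ?I \<Longrightarrow> Z i \<in> sets uniform01"
    let ?Y = "\<lambda>w. {t \<in> {0..1}. p t \<in> Z (True, w) \<and> q t \<in> Z (False, w)}"
    have Y: "?Y w \<in> sets uniform01" if "w \<in> A \<union> B" for w
      using sets.Int[OF measurable_sets[OF pq_measurable(1) Z[of "(True, w)"]]
          measurable_sets[OF pq_measurable(2) Z[of "(False, w)"]]] that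
      by (simp add: vimage_def Int_def conj_ac cong: conj_cong)
    have "emeasure (distr cube (\<Pi>\<^sub>M i\<in>?I. uniform01) (\<lambda>x. \<lambda>i\<in>?I. coord i x)) (Pi\<^sub>E ?I Z)
        = emeasure cube (Pi\<^sub>E (A \<union> B) ?Y)"
    proof (subst emeasure_distr)
      show "(\<lambda>x. \<lambda>i\<in>?I. coord i x) \<in> cube \<rightarrow>\<^sub>M (\<Pi>\<^sub>M i\<in>?I. uniform01)"
        by (intro measurable_restrict coord_measurable) auto
      show "Pi\<^sub>E ?I Z \<in> sets (\<Pi>\<^sub>M i\<in>?I. uniform01)"
        by (intro sets_PiM_I_finite fin Z)
      have "(\<lambda>x. \<lambda>i\<in>?I. coord i x) -` Pi\<^sub>E ?I Z \<inter> space cube = Pi\<^sub>E (A \<union> B) ?Y"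
        unfolding UNIV_bool by (auto simp: space_PiM PiE_iff coord_def)
      then show "emeasure cube ((\<lambda>x. \<lambda>i\<in>?I. coord i x) -` Pi\<^sub>E ?I Z \<inter> space cube)
          = emeasure cube (Pi\<^sub>E (A \<union> B) ?Y)" by simp
    qed
    also have "\<dots> = (\<Prod>w\<in>A \<union> B. emeasure uniform01 (?Y w))"
      by (rule cube.emeasure_PiM[OF finite_vertices Y])
    also have "\<dots> = (\<Prod>w\<in>A \<union> B. emeasure uniform01 (Z (True, w)) * emeasure uniform01 (Z (False, w)))"
      by (intro prod.cong refl emeasure_pair_preimage Z) auto
    also have "\<dots> = (\<Prod>b\<in>UNIV. \<Prod>w\<in>A \<union> B. emeasure uniform01 (Z (b, w)))"
      by (simp add: UNIV_bool prod.distrib mult.commute)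
    also have "\<dots> = (\<Prod>i\<in>?I. emeasure uniform01 (Z i))"
      by (simp add: prod.cartesian_product split_def)
    finally show "emeasure (distr cube (\<Pi>\<^sub>M i\<in>?I. uniform01) (\<lambda>x. \<lambda>i\<in>?I. coord i x)) (Pi\<^sub>E ?I Z)
        = (\<Prod>i\<in>?I. emeasure uniform01 (Z i))" .
  qed simp
  moreover have "(\<Pi>\<^sub>M i\<in>?I. distr cube uniform01 (coord i)) = (\<Pi>\<^sub>M i\<in>?I. uniform01)"
    by (intro PiM_cong distr_coord) auto
  ultimately show ?thesis
    using nonempty by (subst cube.P.indep_vars_iff_distr_eq_PiM') (auto intro: coord_measurable)
qed

text \<open>The integrand is a function of the \<open>p\<close>-halves times a function of the
  \<open>q\<close>-halves of the variables. These groups are independent, so the expectation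
  factors, and \<open>hom_compose\<close> identifies each factor.\<close>

lemma hom_tens:
  assumes F: "\<And>e. e \<in> E \<Longrightarrow> F e \<in> bdd_borel" and G: "\<And>e. e \<in> E \<Longrightarrow> G e \<in> bdd_borel"
  shows "hom (\<lambda>e. tens (F e) (G e)) = hom F * hom G"
proof -
  define K :: "bool \<Rightarrow> (bool \<times> 'v) set" where "K b = {b} \<times> (A \<union> B)" for b
  define h where "h b H y = (\<Prod>e\<in>E. H e (y (b, fst e), y (b, snd e)))"
    for b and H :: "'v \<times> 'v \<Rightarrow> real \<times> real \<Rightarrow> complex" and y :: "bool \<times> 'v \<Rightarrow> real"
  let ?P = "\<lambda>b. \<Pi>\<^sub>M i\<in>K b. uniform01"
  let ?R = "\<lambda>b x. restrict (\<lambda>i. coord i x) (K b)"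
  have h: "h b H \<in> borel_measurable (?P b)" if "\<And>e. e \<in> E \<Longrightarrow> H e \<in> bdd_borel" for b H
    unfolding h_def
  proof (rule borel_measurable_prod)
    fix e assume e: "e \<in> E"
    have "(\<lambda>y. (y (b, fst e), y (b, snd e))) \<in> ?P b \<rightarrow>\<^sub>M uniform01 \<Otimes>\<^sub>M uniform01"
      using edge_verts[OF e] by (intro measurable_Pair measurable_component_singleton) (auto simp: K_def)
    from measurable_compose[OF this measurable_compose[OF uniform01_pair_borel bdd_borelD[OF that[OF e]]]]
    show "(\<lambda>y. H e (y (b, fst e), y (b, snd e))) \<in> borel_measurable (?P b)" .
  qed
  have hR: "h b H (?R b x) = (\<Prod>e\<in>E. H e ((if b then p else q) (x (fst e)), (if b then p else q) (x (snd e))))" for b H x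
    unfolding h_def by (intro prod.cong refl) (use edge_verts in \<open>auto simp: K_def coord_def\<close>)
  have "cube.P.indep_var (?P True) (?R True) (?P False) (?R False)"
    by (rule cube.P.indep_var_restrict[OF indep_coord]) (auto simp: K_def)
  then have "cube.P.indep_var borel (h True F \<circ> ?R True) borel (h False G \<circ> ?R False)"
    by (rule cube.P.indep_var_compose) (intro h F G; assumption)+
  moreover have int: "integrable cube (h b H \<circ> ?R b)" if "\<And>e. e \<in> E \<Longrightarrow> H e \<in> bdd_borel" for b H
    using integrable_integrand[of "\<lambda>e z. H e ((if b then p else q) (fst z), (if b then p else q) (snd z))"]
      bdd_borel_compose[OF that, of _ "if b then p else q"] p_measurable q_measurable
    by (simp add: comp_def hR)
  ultimately have "cube.P.expectation (\<lambda>x. (h True F \<circ> ?R True) x * (h False G \<circ> ?R False) x)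
      = cube.P.expectation (h True F \<circ> ?R True) * cube.P.expectation (h False G \<circ> ?R False)"
    by (intro cube.P.indep_var_lebesgue_integral int F G)
  also have "cube.P.expectation (h True F \<circ> ?R True) = hom F"
    unfolding comp_def hR using hom_compose[of p F] F by simp
  also have "cube.P.expectation (h False G \<circ> ?R False) = hom G"
    unfolding comp_def hR using hom_compose[of q G] G by simp
  finally show ?thesis
    unfolding comp_def hR by (simp add: hom_def tens_def prod.distrib)
qed

end

section \<open>Conjugated densities\<close>

text \<open>
  Weighting the power sums by the coefficients of a polynomial that vanishes at all the other values
  isolates the powers of \<open>a j\<close>.
\<close>

lemma norm_le_one_of_bounded_power_sums:
  fixes a :: "'i \<Rightarrow> complex"
  assumes J: "finite J" "j \<in> J" and bound: "\<And>k. cmod (\<Sum>i\<in>J. a i ^ k) \<le> M"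
  shows "cmod (a j) \<le> 1"
proof (rule ccontr)
  assume "\<not> cmod (a j) \<le> 1"
  then have gt: "1 < cmod (a j)" by simp
  define Q where "Q = (\<Prod>c\<in>a ` J - {a j}. [:- c, 1:])"
  have Q0: "poly Q (a i) = 0" if "i \<in> J" "a i \<noteq> a j" for i
    using that J by (auto simp: Q_def poly_prod)
  have Qj: "poly Q (a j) \<noteq> 0"
    using J by (auto simp: Q_def poly_prod)
  \<comment> \<open>Several indices may share the value \<open>a j\<close>; its multiplicity
    \<open>n\<close> is at least 1, so dividing it out only helps the bound, which does not depend
    on \<open>k\<close>.\<close>
  define n where "n = card {i \<in> J. a i = a j}"
  have n: "1 \<le> n"
    using J by (auto simp: n_def Suc_le_eq card_gt_0_iff)
  define B where "B = (\<Sum>l\<le>degree Q. cmod (coeff Q l) * M)"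
  have le: "cmod (a j) ^ k * cmod (poly Q (a j)) \<le> B" for k
  proof -
    have "(\<Sum>i\<in>J. a i ^ k * poly Q (a i)) = (\<Sum>i\<in>{i \<in> J. a i = a j}. a i ^ k * poly Q (a i))"
      using J Q0 by (intro sum.mono_neutral_right) auto
    also have "\<dots> = of_nat n * (a j ^ k * poly Q (a j))"
      by (simp add: n_def)
    finally have 1: "(\<Sum>i\<in>J. a i ^ k * poly Q (a i)) = of_nat n * (a j ^ k * poly Q (a j))" .
    have "(\<Sum>i\<in>J. a i ^ k * poly Q (a i)) = (\<Sum>i\<in>J. \<Sum>l\<le>degree Q. coeff Q l * a i ^ (k + l))"
      by (simp add: poly_altdef sum_distrib_left power_add mult_ac)
    also have "\<dots> = (\<Sum>l\<le>degree Q. coeff Q l * (\<Sum>i\<in>J. a i ^ (k + l)))"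
      by (subst sum.swap) (simp add: sum_distrib_left)
    also have "cmod \<dots> \<le> B"
      unfolding B_def by (intro sum_norm_le) (auto simp: norm_mult intro!: mult_left_mono bound)
    finally have "real n * (cmod (a j) ^ k * cmod (poly Q (a j))) \<le> B"
      by (simp add: 1 norm_mult norm_power)
    moreover have "1 * (cmod (a j) ^ k * cmod (poly Q (a j))) \<le> real n * (cmod (a j) ^ k * cmod (poly Q (a j)))"
      using n by (intro mult_right_mono) auto
    ultimately show ?thesis by simp
  qed
  obtain k where "B / cmod (poly Q (a j)) < cmod (a j) ^ k"
    using real_arch_pow[OF gt] by blast
  then show False
    using le[of k] Qj by (simp add: divide_less_eq)
qed

definition twist :: "nat \<Rightarrow> ('a \<Rightarrow> complex) \<Rightarrow> 'a \<Rightarrow> complex" where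
  "twist a f z = f z ^ a * cnj (f z) ^ (1 - a)"

lemma twist_1 [simp]: "twist 1 f = f" "twist (Suc 0) f = f"
  by (simp_all add: twist_def fun_eq_iff)

lemma twist_0: "twist 0 f = (\<lambda>z. cnj (f z))"
  by (simp add: twist_def fun_eq_iff)

lemma bdd_borel_twist: "a \<in> {0, 1} \<Longrightarrow> f \<in> bdd_borel \<Longrightarrow> twist a f \<in> bdd_borel"
  by (auto simp: twist_0 bdd_borel_cnj)

lemma bdd_borel_Re_meas:
  assumes "f \<in> bdd_borel"
  shows "(\<lambda>z. Re (f z)) \<in> bdd_meas"
proof -
  obtain b where b: "\<And>z. cmod (f z) \<le> b" using bdd_borel_bound[OF assms] by metis
  have "(\<lambda>z. Re (f z)) \<in> borel_measurable lborel"
    using bdd_borelD[OF assms] by simp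
  moreover have "bounded ((\<lambda>z. Re (f z)) ` unit_square)"
    using order_trans[OF abs_Re_le_cmod b] by (intro boundedI[where B = b]) auto
  ultimately show ?thesis
    by (auto simp: bdd_meas_def intro!: measurable_restrict_space1 measurable_completion)
qed

section \<open>Conjugated densities and their maximal modulus\<close>

context bipartite_graph
begin

abbreviation conj_choices :: "('v \<times> 'v \<Rightarrow> nat) set" where
  "conj_choices \<equiv> E \<rightarrow>\<^sub>E {0, 1}"

abbreviation edge_root :: "real \<Rightarrow> real" where
  "edge_root x \<equiv> x powr (1 / real (card E))"

abbreviation hom_conj :: "('v \<times> 'v \<Rightarrow> nat) \<Rightarrow> (real \<times> real \<Rightarrow> complex) \<Rightarrow> complex" where
  "hom_conj \<alpha> f \<equiv> hom (\<lambda>e. twist (\<alpha> e) f)"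

lemma edge_root_power: "0 \<le> x \<Longrightarrow> edge_root x ^ card E = x"
  using card_edges_pos by (cases "x = 0") (simp_all add: powr_powr flip: powr_realpow)

lemma power_edge_root: "0 \<le> x \<Longrightarrow> edge_root (x ^ card E) = x"
  using card_edges_pos by (simp add: edge_root_power power_eq_iff_eq_base[symmetric, of "card E" _ x])

lemma edge_root_le_iff: "0 \<le> x \<Longrightarrow> 0 \<le> y \<Longrightarrow> edge_root x \<le> y \<longleftrightarrow> x \<le> y ^ card E"
  using card_edges_pos by (metis edge_root_power power_edge_root power_mono powr_ge_zero powr_mono2 zero_le_divide_1_iff of_nat_0_le_iff)

lemma finite_conj_choices: "finite conj_choices"
  by (intro finite_PiE finite_edges) auto

lemma conj_choices_nonempty: "conj_choices \<noteq> {}"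
  by (auto simp: PiE_eq_empty_iff)

lemma conj_choicesD: "\<alpha> \<in> conj_choices \<Longrightarrow> e \<in> E \<Longrightarrow> \<alpha> e \<in> {0, 1}"
  by (rule PiE_mem)

text \<open>Borel integrands are already measurable for the uncompleted product, and completion
  preserves their integrals.\<close>

lemma t_hom_conj_eq:
  assumes "\<alpha> \<in> conj_choices" "f \<in> bdd_borel"
  shows "t_hom_conj A B E \<alpha> f = hom_conj \<alpha> f"
proof -
  have "(\<lambda>x. \<Prod>e\<in>E. twist (\<alpha> e) f (x (fst e), x (snd e))) \<in> borel_measurable cube"
    by (intro measurable_integrand bdd_borelD[OF bdd_borel_twist] conj_choicesD assms)
  from integral_completion[OF this] show ?thesis
    by (simp add: t_hom_conj_def cube_measure_def hom_def twist_def split_def)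
qed

text \<open>A real function is carried here by a complex-valued \<open>f\<close> with real values,
  so that the expansions available for \<open>hom\<close> apply to \<open>t_hom\<close>.\<close>

lemma t_hom_eq:
  assumes "f \<in> bdd_borel" "\<And>z. f z \<in> \<real>"
  shows "complex_of_real (t_hom A B E (\<lambda>z. Re (f z))) = hom (\<lambda>_. f)"
proof -
  have "(\<lambda>x. \<Prod>e\<in>E. f (x (fst e), x (snd e))) \<in> borel_measurable cube"
    by (intro measurable_integrand bdd_borelD assms)
  from integral_completion[OF this] assms(2) show ?thesis
    by (simp add: t_hom_def cube_measure_def hom_def split_def flip: integral_complex_of_real)
qed

lemma s_max_eq:
  assumes "f \<in> bdd_borel"
  shows "s_max A B E f = (MAX \<alpha>\<in>conj_choices. cmod (hom_conj \<alpha> f))"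
  unfolding s_max_def using assms by (simp add: t_hom_conj_eq cong: image_cong_simp)

lemma s_max_ge:
  assumes "f \<in> bdd_borel" "\<alpha> \<in> conj_choices"
  shows "cmod (hom_conj \<alpha> f) \<le> s_max A B E f"
  using assms finite_conj_choices by (simp add: s_max_eq)

lemma s_max_attained:
  assumes "f \<in> bdd_borel"
  obtains \<alpha> where "\<alpha> \<in> conj_choices" "s_max A B E f = cmod (hom_conj \<alpha> f)"
proof -
  have "Max ((\<lambda>\<alpha>. cmod (hom_conj \<alpha> f)) ` conj_choices) \<in> (\<lambda>\<alpha>. cmod (hom_conj \<alpha> f)) ` conj_choices"
    using finite_conj_choices conj_choices_nonempty by (intro Max_in) auto
  then show thesis
    unfolding s_max_eq[OF assms, symmetric] using that by blast
qed

lemma s_max_eqI: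
  assumes "f \<in> bdd_borel" "g \<in> bdd_borel" "0 \<le> c"
    and "\<And>\<alpha>. \<alpha> \<in> conj_choices \<Longrightarrow> cmod (hom_conj \<alpha> g) = c * cmod (hom_conj \<alpha> f)"
  shows "s_max A B E g = c * s_max A B E f"
proof (rule antisym)
  show "s_max A B E g \<le> c * s_max A B E f"
    using s_max_attained[OF assms(2)] s_max_ge[OF assms(1)] assms(3,4) by (metis mult_left_mono)
  show "c * s_max A B E f \<le> s_max A B E g"
    using s_max_attained[OF assms(1)] s_max_ge[OF assms(2)] assms(4) by metis
qed

lemma s_max_nonneg: "f \<in> bdd_borel \<Longrightarrow> 0 \<le> s_max A B E f"
  by (metis s_max_attained norm_ge_zero)

text \<open>Every edge contributes a factor \<open>c\<close> or its conjugate, both of modulus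
  \<open>cmod c\<close>.\<close>

lemma norm_hom_conj_scale:
  assumes "\<alpha> \<in> conj_choices"
  shows "cmod (hom_conj \<alpha> (\<lambda>z. c * f z)) = cmod c ^ card E * cmod (hom_conj \<alpha> f)"
proof -
  let ?c = "\<lambda>e. c ^ \<alpha> e * cnj c ^ (1 - \<alpha> e)"
  have "hom_conj \<alpha> (\<lambda>z. c * f z) = hom (\<lambda>e z. ?c e * twist (\<alpha> e) f z)"
    by (simp add: twist_def[abs_def] power_mult_distrib mult_ac)
  also have "\<dots> = (\<Prod>e\<in>E. ?c e) * hom_conj \<alpha> f"
    by (rule hom_scale)
  also have "cmod \<dots> = (\<Prod>e\<in>E. cmod (?c e)) * cmod (hom_conj \<alpha> f)"
    by (simp add: norm_mult flip: prod_norm)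
  also have "(\<Prod>e\<in>E. cmod (?c e)) = (\<Prod>e\<in>E. cmod c)"
  proof (rule prod.cong)
    fix e assume "e \<in> E"
    from conj_choicesD[OF assms this] show "cmod (?c e) = cmod c" by auto
  qed simp
  finally show ?thesis by simp
qed

lemma s_max_scale:
  assumes "f \<in> bdd_borel"
  shows "s_max A B E (\<lambda>z. c * f z) = cmod c ^ card E * s_max A B E f"
  by (rule s_max_eqI) (auto simp: assms norm_hom_conj_scale intro: bdd_borel_mult bdd_borel_const)

text \<open>Conjugating \<open>f\<close> conjugates every factor and hence the integral, whatever
  \<open>\<alpha>\<close> is.\<close>

lemma norm_hom_conj_twist:
  assumes "\<alpha> \<in> conj_choices" "a \<in> {0, 1}"
  shows "cmod (hom_conj \<alpha> (twist a f)) = cmod (hom_conj \<alpha> f)"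
proof (cases "a = 0")
  case True
  have "hom_conj \<alpha> (twist a f) = hom (\<lambda>e z. cnj (twist (\<alpha> e) f z))"
    using True by (simp add: twist_def[abs_def])
  then show ?thesis by (simp add: hom_cnj)
qed (use assms in auto)

lemma s_max_twist: "f \<in> bdd_borel \<Longrightarrow> a \<in> {0, 1} \<Longrightarrow> s_max A B E (twist a f) = s_max A B E f"
  using s_max_eqI[of f "twist a f" 1] by (simp add: norm_hom_conj_twist bdd_borel_twist)

end

section \<open>Tensor powers\<close>

context paired_graph
begin

primrec tens_power :: "(real \<times> real \<Rightarrow> complex) \<Rightarrow> nat \<Rightarrow> real \<times> real \<Rightarrow> complex" where
  "tens_power f 0 = (\<lambda>_. 1)"
| "tens_power f (Suc k) = tens f (tens_power f k)"

lemma bdd_borel_tens_power: "f \<in> bdd_borel \<Longrightarrow> tens_power f k \<in> bdd_borel"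
  by (induction k) (auto simp: bdd_borel_const bdd_borel_tens)

lemma twist_tens: "twist a (tens f g) = tens (twist a f) (twist a g)"
  by (simp add: twist_def tens_def power_mult_distrib fun_eq_iff mult_ac)

lemma twist_tens_power: "twist a (tens_power f k) = tens_power (twist a f) k"
  by (induction k) (simp_all add: twist_tens, simp add: twist_def fun_eq_iff)

lemma hom_tens_power:
  assumes "\<And>e. e \<in> E \<Longrightarrow> F e \<in> bdd_borel"
  shows "hom (\<lambda>e. tens_power (F e) k) = hom F ^ k"
proof (induction k)
  case (Suc k)
  then show ?case
    by (simp add: hom_tens[OF assms bdd_borel_tens_power[OF assms]])
qed (simp add: hom_one)

end

section \<open>The Hoelder inequality\<close>

lemma is_seminormD:
  assumes "is_seminorm N" "f \<in> bdd_meas"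
  shows is_seminorm_scale: "N (\<lambda>z. c * f z) = norm c * N f"
    and is_seminorm_triangle: "g \<in> bdd_meas \<Longrightarrow> N (\<lambda>z. f z + g z) \<le> N f + N g"
  using assms unfolding is_seminorm_def by blast+

lemma is_norm_is_seminorm: "is_norm N \<Longrightarrow> is_seminorm N"
  by (simp add: is_norm_def)

lemma is_norm_eq_0D: "is_norm N \<Longrightarrow> f \<in> bdd_meas \<Longrightarrow> N f = 0 \<Longrightarrow> AE z in lebesgue_on unit_square. f z = 0"
  by (simp add: is_norm_def)

lemma seminorm_sum_le:
  fixes N :: "(real \<times> real \<Rightarrow> real) \<Rightarrow> real"
  assumes N: "is_seminorm N" and J: "finite J" and f: "\<And>j. j \<in> J \<Longrightarrow> f j \<in> bdd_borel"
  shows "N (\<lambda>z. Re (\<Sum>j\<in>J. f j z)) \<le> (\<Sum>j\<in>J. N (\<lambda>z. Re (f j z)))"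
  using J f
proof (induction J rule: finite_induct)
  case empty
  have "(\<lambda>_. 0) \<in> (bdd_meas :: (real \<times> real \<Rightarrow> real) set)"
    using bdd_borel_Re_meas[OF bdd_borel_const[of 0]] by simp
  from is_seminorm_scale[OF N this, of 0]
  show ?case by simp
next
  case (insert j J)
  from is_seminorm_triangle[OF N bdd_borel_Re_meas bdd_borel_Re_meas[OF bdd_borel_sum], of "f j" J f]
  have "N (\<lambda>z. Re (f j z) + Re (\<Sum>j\<in>J. f j z)) \<le> N (\<lambda>z. Re (f j z)) + N (\<lambda>z. Re (\<Sum>j\<in>J. f j z))"
    using insert.prems by simp
  with insert show ?case by simp
qed

context paired_graph
begin

lemma sum_twist_real: "(\<Sum>a\<in>{0, 1}. twist a f z) \<in> \<real>"
  by (simp add: twist_0 complex_is_Real_iff)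

text \<open>The sum of \<open>f\<close> and its conjugate is twice the real part. Expanding the
  density chooses one of the two at each edge, so every conjugation pattern occurs once.\<close>

lemma t_hom_double_Re:
  assumes "f \<in> bdd_borel"
  shows "complex_of_real (t_hom A B E (\<lambda>z. Re (\<Sum>a\<in>{0, 1}. twist a f z))) = (\<Sum>\<alpha>\<in>conj_choices. hom_conj \<alpha> f)"
proof -
  have "complex_of_real (t_hom A B E (\<lambda>z. Re (\<Sum>a\<in>{0, 1}. twist a f z)))
      = hom (\<lambda>_ z. \<Sum>a\<in>{0, 1}. twist a f z)"
    by (intro t_hom_eq bdd_borel_sum bdd_borel_twist assms sum_twist_real)
  also have "\<dots> = (\<Sum>\<alpha>\<in>conj_choices. hom_conj \<alpha> f)"
    by (rule hom_sum) (auto intro!: bdd_borel_twist assms)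
  finally show ?thesis .
qed

text \<open>The normalisation \<open>s_max \<le> 1\<close> keeps the conjugated densities of all
  tensor powers bounded, so that the real norm gives a bound uniform in \<open>k\<close> and
  \<open>norm_le_one_of_bounded_power_sums\<close> applies.\<close>

lemma hoelder_unit:
  assumes norming: "real_norming A B E"
    and f: "\<And>e. e \<in> E \<Longrightarrow> f e \<in> bdd_borel" "\<And>e. e \<in> E \<Longrightarrow> s_max A B E (f e) \<le> 1"
  shows "cmod (hom f) \<le> 1"
proof -
  let ?N = "\<lambda>f. edge_root \<bar>t_hom A B E f\<bar>"
  let ?J = "E \<times> {0, 1::nat}"
  \<comment> \<open>Twice the real part of the \<open>k\<close>-th tensor power of
    \<open>f d\<close>: a real function, to which the real norm applies.\<close>
  define D where "D d k z = (\<Sum>a\<in>{0, 1}. twist a (tens_power (f d) k) z)" for d k z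
  define a where "a \<phi> = hom (\<lambda>e. twist (snd (\<phi> e)) (f (fst (\<phi> e))))" for \<phi> :: "'v \<times> 'v \<Rightarrow> ('v \<times> 'v) \<times> nat"
  define c where "c = real (card E) * edge_root (real (card conj_choices))"
  have D: "D d k \<in> bdd_borel" if "d \<in> E" for d k
    unfolding D_def[abs_def] by (intro bdd_borel_sum bdd_borel_twist bdd_borel_tens_power f that)
  have N: "is_seminorm ?N"
    using norming by (simp add: real_norming_def is_norm_is_seminorm)
  \<comment> \<open>The expansion has one term per conjugation pattern, each the \<open>k\<close>-th
    power of a number of modulus at most 1.\<close>
  have ND: "?N (\<lambda>z. Re (D d k z)) \<le> edge_root (real (card conj_choices))" if d: "d \<in> E" for d k
  proof -
    have "complex_of_real (t_hom A B E (\<lambda>z. Re (D d k z))) = (\<Sum>\<alpha>\<in>conj_choices. hom_conj \<alpha> (tens_power (f d) k))"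
      unfolding D_def by (rule t_hom_double_Re[OF bdd_borel_tens_power[OF f(1)[OF d]]])
    also have "\<dots> = (\<Sum>\<alpha>\<in>conj_choices. hom_conj \<alpha> (f d) ^ k)"
      unfolding twist_tens_power
      by (intro sum.cong refl hom_tens_power bdd_borel_twist conj_choicesD f d)
    also have "cmod \<dots> \<le> of_nat (card conj_choices) * 1"
    proof (rule sum_norm_bound)
      fix \<alpha> assume "\<alpha> \<in> conj_choices"
      then have "cmod (hom_conj \<alpha> (f d)) \<le> 1"
        using s_max_ge[OF f(1)[OF d]] f(2)[OF d] by (metis order_trans)
      then show "cmod (hom_conj \<alpha> (f d) ^ k) \<le> 1"
        by (simp add: norm_power power_le_one)
    qed
    finally show ?thesis by (intro powr_mono2) auto
  qed
  \<comment> \<open>Expanding the density of the sum of all \<open>D d k\<close> picks a function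
    \<open>f d\<close> and a conjugation at each edge; by multiplicativity the terms are the powers
    \<open>a \<phi> ^ k\<close>.\<close>
  have bound: "cmod (\<Sum>\<phi>\<in>E \<rightarrow>\<^sub>E ?J. a \<phi> ^ k) \<le> c ^ card E" for k
  proof -
    let ?G = "\<lambda>z. \<Sum>d\<in>E. D d k z"
    have "?N (\<lambda>z. Re (?G z)) \<le> (\<Sum>d\<in>E. ?N (\<lambda>z. Re (D d k z)))"
      by (rule seminorm_sum_le[OF N finite_edges D])
    also have "\<dots> \<le> c"
      using sum_bounded_above[OF ND] by (simp add: c_def)
    finally have le: "\<bar>t_hom A B E (\<lambda>z. Re (?G z))\<bar> \<le> c ^ card E"
      by (subst (asm) edge_root_le_iff) (auto simp: c_def)
    have "complex_of_real (t_hom A B E (\<lambda>z. Re (?G z))) = hom (\<lambda>_. ?G)"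
      by (intro t_hom_eq bdd_borel_sum D) (auto simp: D_def intro!: sum_in_Reals sum_twist_real[simplified])
    also have "\<dots> = hom (\<lambda>_ z. \<Sum>j\<in>?J. twist (snd j) (tens_power (f (fst j)) k) z)"
      unfolding D_def by (simp only: sum.cartesian_product split_def)
    also have "\<dots> = (\<Sum>\<phi>\<in>E \<rightarrow>\<^sub>E ?J. hom (\<lambda>e. twist (snd (\<phi> e)) (tens_power (f (fst (\<phi> e))) k)))"
      by (rule hom_sum) (use finite_edges f in \<open>auto intro!: bdd_borel_twist bdd_borel_tens_power\<close>)
    also have "\<dots> = (\<Sum>\<phi>\<in>E \<rightarrow>\<^sub>E ?J. a \<phi> ^ k)"
      unfolding twist_tens_power a_def
    proof (intro sum.cong refl hom_tens_power bdd_borel_twist f)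
      fix \<phi> e assume "\<phi> \<in> E \<rightarrow>\<^sub>E ?J" "e \<in> E"
      then have "\<phi> e \<in> ?J" by (rule PiE_mem)
      then show "snd (\<phi> e) \<in> {0, 1}" "fst (\<phi> e) \<in> E" by auto
    qed
    finally show ?thesis using le by (metis norm_of_real real_norm_def)
  qed
  \<comment> \<open>Each edge picks its own function, unconjugated.\<close>
  let ?\<phi> = "\<lambda>e\<in>E. (e, 1)"
  have "cmod (a ?\<phi>) \<le> 1"
    by (rule norm_le_one_of_bounded_power_sums[OF _ _ bound])
      (auto intro!: finite_PiE finite_edges)
  also have "a ?\<phi> = hom f"
    unfolding a_def by (rule hom_cong) auto
  finally show ?thesis .
qed

text \<open>Homogeneity reduces this to \<open>hoelder_unit\<close>. The functions are divided by
  the root of \<open>s_max\<close> plus \<open>\<epsilon>\<close>, which stays positive when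
  \<open>s_max\<close> vanishes; then \<open>\<epsilon>\<close> tends to 0.\<close>

lemma hoelder:
  assumes norming: "real_norming A B E" and f: "\<And>e. e \<in> E \<Longrightarrow> f e \<in> bdd_borel"
  shows "cmod (hom f) \<le> (\<Prod>e\<in>E. edge_root (s_max A B E (f e)))"
proof (rule tendsto_lowerbound)
  let ?b = "\<lambda>\<epsilon> e. edge_root (s_max A B E (f e)) + \<epsilon>"
  show "((\<lambda>\<epsilon>. \<Prod>e\<in>E. ?b \<epsilon> e) \<longlongrightarrow> (\<Prod>e\<in>E. edge_root (s_max A B E (f e)))) (at_right 0)"
    by (intro tendsto_prod) (auto intro!: tendsto_eq_intros)
  show "\<forall>\<^sub>F \<epsilon> in at_right 0. cmod (hom f) \<le> (\<Prod>e\<in>E. ?b \<epsilon> e)"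
  proof (rule eventually_at_right_less[THEN eventually_mono])
    fix \<epsilon> :: real assume eps: "0 < \<epsilon>"
    then have b: "0 < ?b \<epsilon> e" for e by (simp add: add_nonneg_pos)
    let ?f = "\<lambda>e z. complex_of_real (1 / ?b \<epsilon> e) * f e z"
    have "cmod (hom ?f) \<le> 1"
    proof (rule hoelder_unit[OF norming])
      fix e assume e: "e \<in> E"
      show "?f e \<in> bdd_borel" by (intro bdd_borel_mult bdd_borel_const f e)
      have "s_max A B E (f e) \<le> ?b \<epsilon> e ^ card E"
        using b[of e] eps s_max_nonneg[OF f[OF e]] by (subst edge_root_le_iff[symmetric]) auto
      then show "s_max A B E (?f e) \<le> 1"
        using b[of e] unfolding s_max_scale[OF f[OF e]] norm_of_real
        by (simp add: power_one_over divide_le_eq)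
    qed
    also have "hom ?f = (\<Prod>e\<in>E. complex_of_real (1 / ?b \<epsilon> e)) * hom f"
      by (rule hom_scale)
    also have "cmod \<dots> = cmod (hom f) / (\<Prod>e\<in>E. ?b \<epsilon> e)"
    proof -
      have b1: "cmod (complex_of_real (1 / ?b \<epsilon> e)) = 1 / ?b \<epsilon> e" for e
        using b[of e] unfolding norm_of_real by simp
      have "cmod (\<Prod>e\<in>E. complex_of_real (1 / ?b \<epsilon> e)) = (\<Prod>e\<in>E. 1 / ?b \<epsilon> e)"
        unfolding prod_norm[symmetric] b1 ..
      also have "\<dots> = 1 / (\<Prod>e\<in>E. ?b \<epsilon> e)"
        by (subst prod_dividef) simp
      finally show ?thesis unfolding norm_mult by simp
    qed
    finally show "cmod (hom f) \<le> (\<Prod>e\<in>E. ?b \<epsilon> e)"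
      using prod_pos[of E "?b \<epsilon>"] b by (simp add: divide_le_eq)
  qed
qed simp

text \<open>For a choice \<open>\<alpha>\<close> maximising the sum, \<open>hom_conj\<close> expands
  into mixed densities, each bounded by Hoelder; conjugating a function leaves its
  \<open>s_max\<close> unchanged.\<close>

lemma s_max_triangle:
  assumes norming: "real_norming A B E" and f: "f \<in> bdd_borel" and g: "g \<in> bdd_borel"
  shows "edge_root (s_max A B E (\<lambda>z. f z + g z)) \<le> edge_root (s_max A B E f) + edge_root (s_max A B E g)"
proof -
  have fg: "(\<lambda>z. f z + g z) \<in> bdd_borel" by (rule bdd_borel_add[OF f g])
  define h where "h j = (if j = (0::nat) then f else g)" for j
  have h: "h j \<in> bdd_borel" for j using f g by (simp add: h_def)
  obtain \<alpha> where \<alpha>: "\<alpha> \<in> conj_choices" "s_max A B E (\<lambda>z. f z + g z) = cmod (hom_conj \<alpha> (\<lambda>z. f z + g z))"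
    using s_max_attained[OF fg] .
  have tw: "twist (\<alpha> e) (h j) \<in> bdd_borel" if "e \<in> E" for e j
    using bdd_borel_twist[OF conj_choicesD[OF \<alpha>(1) that] h] .
  have "hom_conj \<alpha> (\<lambda>z. f z + g z) = hom (\<lambda>e z. \<Sum>j\<in>{0, 1}. twist (\<alpha> e) (h j) z)"
  proof (rule hom_cong)
    fix e z assume "e \<in> E"
    from conj_choicesD[OF \<alpha>(1) this] show "twist (\<alpha> e) (\<lambda>z. f z + g z) z = (\<Sum>j\<in>{0, 1}. twist (\<alpha> e) (h j) z)"
      by (auto simp: twist_0 h_def)
  qed
  also have "\<dots> = (\<Sum>\<phi>\<in>E \<rightarrow>\<^sub>E {0, 1}. hom (\<lambda>e. twist (\<alpha> e) (h (\<phi> e))))"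
    by (rule hom_sum) (auto intro: tw)
  also have "cmod \<dots> \<le> (\<Sum>\<phi>\<in>E \<rightarrow>\<^sub>E {0, 1}. \<Prod>e\<in>E. edge_root (s_max A B E (h (\<phi> e))))"
  proof (rule sum_norm_le)
    fix \<phi> :: "'v \<times> 'v \<Rightarrow> nat"
    have "cmod (hom (\<lambda>e. twist (\<alpha> e) (h (\<phi> e)))) \<le> (\<Prod>e\<in>E. edge_root (s_max A B E (twist (\<alpha> e) (h (\<phi> e)))))"
      by (rule hoelder[OF norming tw])
    also have "\<dots> = (\<Prod>e\<in>E. edge_root (s_max A B E (h (\<phi> e))))"
      by (intro prod.cong refl arg_cong[where f = edge_root] s_max_twist h conj_choicesD[OF \<alpha>(1)])
    finally show "cmod (hom (\<lambda>e. twist (\<alpha> e) (h (\<phi> e)))) \<le> (\<Prod>e\<in>E. edge_root (s_max A B E (h (\<phi> e))))" .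
  qed
  \<comment> \<open>Each factor depends only on the function chosen at its edge, so the sum of
    products folds back into a product of sums.\<close>
  also have "\<dots> = (\<Prod>e\<in>E. \<Sum>j\<in>{0, 1}. edge_root (s_max A B E (h j)))"
    by (rule prod_sum_PiE[symmetric]) (auto intro: finite_edges)
  also have "\<dots> = (edge_root (s_max A B E f) + edge_root (s_max A B E g)) ^ card E"
    by (simp add: h_def)
  finally show ?thesis
    unfolding \<alpha>(2)[symmetric] using s_max_nonneg[OF fg] by (subst edge_root_le_iff) auto
qed

lemma t_hom_double_Re_eq_0:
  assumes norming: "real_norming A B E" and f: "f \<in> bdd_borel" and 0: "s_max A B E f = 0"
  shows "t_hom A B E (\<lambda>z. 2 * Re (f z)) = 0"
proof -
  have "hom_conj \<alpha> f = 0" if "\<alpha> \<in> conj_choices" for \<alpha>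
    using s_max_ge[OF f that] 0 by simp
  then have "complex_of_real (t_hom A B E (\<lambda>z. Re (\<Sum>a\<in>{0, 1}. twist a f z))) = 0"
    using t_hom_double_Re[OF f] by simp
  then show ?thesis by (simp add: twist_0)
qed

end

section \<open>A universal choice of conjugates\<close>

context paired_graph
begin

lemma hom_conj_tens:
  assumes "\<alpha> \<in> conj_choices" "f \<in> bdd_borel" "g \<in> bdd_borel"
  shows "hom_conj \<alpha> (tens f g) = hom_conj \<alpha> f * hom_conj \<alpha> g"
  unfolding twist_tens
  by (intro hom_tens bdd_borel_twist conj_choicesD[OF assms(1)] assms)

text \<open>A choice maximising the tensor product is a competitor for each factor.\<close>

lemma s_max_tens_le:
  assumes "f \<in> bdd_borel" "g \<in> bdd_borel"
  shows "s_max A B E (tens f g) \<le> s_max A B E f * s_max A B E g"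
proof -
  obtain \<alpha> where \<alpha>: "\<alpha> \<in> conj_choices" "s_max A B E (tens f g) = cmod (hom_conj \<alpha> (tens f g))"
    using s_max_attained[OF bdd_borel_tens[OF assms]] .
  then show ?thesis
    using s_max_ge[OF assms(1) \<alpha>(1)] s_max_ge[OF assms(2) \<alpha>(1)] s_max_nonneg[OF assms(1)]
    by (simp add: hom_conj_tens assms norm_mult mult_mono)
qed

text \<open>
  Let \<open>\<beta>\<close> and \<open>\<gamma>\<close> be maximising choices for \<open>f\<close> and \<open>g\<close>, and apply the Hoelder inequality to the
  functions \<open>tens (twist (\<beta> e) f) (twist (\<gamma> e) g)\<close>: up to conjugation, each of them is \<open>tens f g\<close> or
  \<open>tens f (twist 0 g)\<close>.
\<close>

lemma ex_s_max_tens_twist: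
  assumes norming: "real_norming A B E" and f: "f \<in> bdd_borel" and g: "g \<in> bdd_borel"
  shows "\<exists>a\<in>{0, 1}. s_max A B E (tens f (twist a g)) = s_max A B E f * s_max A B E g"
proof -
  obtain \<beta> where \<beta>: "\<beta> \<in> conj_choices" "s_max A B E f = cmod (hom_conj \<beta> f)"
    using s_max_attained[OF f] .
  obtain \<gamma> where \<gamma>: "\<gamma> \<in> conj_choices" "s_max A B E g = cmod (hom_conj \<gamma> g)"
    using s_max_attained[OF g] .
  let ?s = "\<lambda>a. s_max A B E (tens f (twist a g))"
  have t: "tens f (twist a g) \<in> bdd_borel" if "a \<in> {0, 1}" for a
    by (intro bdd_borel_tens f bdd_borel_twist g that)
  define \<mu> where "\<mu> = max (?s 0) (?s 1)"
  have \<mu>: "0 \<le> \<mu>" "?s a \<le> \<mu>" if "a \<in> {0, 1}" for a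
    using that s_max_nonneg[OF t, of 0] by (auto simp: \<mu>_def)
  have le: "s_max A B E (tens (twist b f) (twist c g)) \<le> \<mu>" if "b \<in> {0, 1}" "c \<in> {0, 1}" for b c
  proof -
    \<comment> \<open>Applying \<open>twist b\<close> to a whole tensor product leaves
      \<open>s_max\<close> unchanged; \<open>a\<close> records whether \<open>f\<close> and
      \<open>g\<close> are conjugated alike.\<close>
    define a where "a = (if b = c then 1 else 0 :: nat)"
    have a: "a \<in> {0, 1}" "twist c g = twist b (twist a g)"
      using that by (auto simp: a_def twist_0)
    then show ?thesis
      using s_max_twist[OF t[OF a(1)] that(1)] \<mu>(2)[OF a(1)] by (simp add: a(2) flip: twist_tens)
  qed
  have \<beta>f: "twist (\<beta> e) f \<in> bdd_borel" and \<gamma>g: "twist (\<gamma> e) g \<in> bdd_borel" if "e \<in> E" for e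
    using bdd_borel_twist[OF conj_choicesD[OF \<beta>(1) that] f] bdd_borel_twist[OF conj_choicesD[OF \<gamma>(1) that] g]
    by auto
  have "s_max A B E f * s_max A B E g = cmod (hom (\<lambda>e. tens (twist (\<beta> e) f) (twist (\<gamma> e) g)))"
    by (simp add: hom_tens[OF \<beta>f \<gamma>g] \<beta>(2) \<gamma>(2) norm_mult)
  also have "\<dots> \<le> (\<Prod>e\<in>E. edge_root (s_max A B E (tens (twist (\<beta> e) f) (twist (\<gamma> e) g))))"
    by (intro hoelder norming bdd_borel_tens \<beta>f \<gamma>g)
  also have "\<dots> \<le> (\<Prod>e\<in>E. edge_root \<mu>)"
    by (intro prod_mono conjI powr_ge_zero powr_mono2 le conj_choicesD[OF \<beta>(1)] conj_choicesD[OF \<gamma>(1)]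
        s_max_nonneg bdd_borel_tens \<beta>f \<gamma>g) auto
  also have "\<dots> = \<mu>"
    using \<mu>(1)[of 0] by (simp add: edge_root_power)
  finally have "\<exists>a\<in>{0, 1}. s_max A B E f * s_max A B E g \<le> ?s a"
    by (auto simp: \<mu>_def le_max_iff_disj)
  then show ?thesis
    using s_max_tens_le[OF f bdd_borel_twist[OF _ g]] s_max_twist[OF g] by (metis antisym)
qed

text \<open>Iterated tensor products. At each step \<open>g\<close> may have to be replaced by its
  conjugate, which changes no modulus \<open>cmod (hom_conj \<alpha> g)\<close>.\<close>

lemma ex_s_max_prod:
  assumes norming: "real_norming A B E" and K: "finite K" "K \<subseteq> bdd_borel"
  shows "\<exists>F\<in>bdd_borel. s_max A B E F = (\<Prod>f\<in>K. s_max A B E f) \<and>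
    (\<forall>\<alpha>\<in>conj_choices. cmod (hom_conj \<alpha> F) = (\<Prod>f\<in>K. cmod (hom_conj \<alpha> f)))"
  using K
proof (induction K rule: finite_induct)
  case empty
  have 1: "hom_conj \<alpha> (\<lambda>_. 1) = 1" for \<alpha>
    using hom_one by (simp add: twist_def[abs_def])
  obtain \<alpha> where "s_max A B E (\<lambda>_. 1) = cmod (hom_conj \<alpha> (\<lambda>_. 1))"
    using s_max_attained[OF bdd_borel_const] by metis
  with 1 show ?case by (intro bexI[OF _ bdd_borel_const[of 1]]) simp
next
  case (insert g K)
  then obtain F where F: "F \<in> bdd_borel" "s_max A B E F = (\<Prod>f\<in>K. s_max A B E f)"
    "\<And>\<alpha>. \<alpha> \<in> conj_choices \<Longrightarrow> cmod (hom_conj \<alpha> F) = (\<Prod>f\<in>K. cmod (hom_conj \<alpha> f))" by auto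
  have g: "g \<in> bdd_borel" using insert.prems by simp
  obtain a where a: "a \<in> {0, 1}" "s_max A B E (tens F (twist a g)) = s_max A B E F * s_max A B E g"
    using ex_s_max_tens_twist[OF norming F(1) g] by blast
  note ag = bdd_borel_twist[OF a(1) g]
  show ?case
  proof (intro bexI conjI ballI)
    show "tens F (twist a g) \<in> bdd_borel" by (rule bdd_borel_tens[OF F(1) ag])
    show "s_max A B E (tens F (twist a g)) = (\<Prod>f\<in>insert g K. s_max A B E f)"
      using insert.hyps by (simp add: a(2) F(2))
    fix \<alpha> assume "\<alpha> \<in> conj_choices"
    then show "cmod (hom_conj \<alpha> (tens F (twist a g))) = (\<Prod>f\<in>insert g K. cmod (hom_conj \<alpha> f))"
      using insert.hyps by (simp add: hom_conj_tens F ag norm_mult norm_hom_conj_twist[OF _ a(1)])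
  qed
qed

text \<open>If every choice failed on some function, these finitely many witnesses would combine
  into \<open>F\<close>; a choice maximising \<open>F\<close> must maximise each of them, including
  its own witness.\<close>

lemma ex_conj_choice_s_max:
  assumes norming: "real_norming A B E"
  shows "\<exists>\<alpha>\<in>conj_choices. \<forall>f\<in>bdd_borel. cmod (hom_conj \<alpha> f) = s_max A B E f"
proof (rule ccontr)
  assume "\<not> ?thesis"
  then have "\<forall>\<alpha>\<in>conj_choices. \<exists>f\<in>bdd_borel. cmod (hom_conj \<alpha> f) < s_max A B E f"
    using s_max_ge by (metis order_le_imp_less_or_eq)
  then obtain f where f: "\<And>\<alpha>. \<alpha> \<in> conj_choices \<Longrightarrow> f \<alpha> \<in> bdd_borel"
    "\<And>\<alpha>. \<alpha> \<in> conj_choices \<Longrightarrow> cmod (hom_conj \<alpha> (f \<alpha>)) < s_max A B E (f \<alpha>)" by metis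
  let ?K = "f ` conj_choices"
  have K: "finite ?K" "?K \<subseteq> bdd_borel" using f(1) finite_conj_choices by auto
  obtain F where F: "F \<in> bdd_borel" "s_max A B E F = (\<Prod>h\<in>?K. s_max A B E h)"
    "\<And>\<alpha>. \<alpha> \<in> conj_choices \<Longrightarrow> cmod (hom_conj \<alpha> F) = (\<Prod>h\<in>?K. cmod (hom_conj \<alpha> h))"
    using ex_s_max_prod[OF norming K] by auto
  obtain \<alpha> where \<alpha>: "\<alpha> \<in> conj_choices" "s_max A B E F = cmod (hom_conj \<alpha> F)"
    using s_max_attained[OF F(1)] .
  have "(\<Prod>h\<in>?K. cmod (hom_conj \<alpha> h)) < (\<Prod>h\<in>?K. s_max A B E h)"
  proof (rule prod_mono_strict)
    show "f \<alpha> \<in> ?K" "cmod (hom_conj \<alpha> (f \<alpha>)) < s_max A B E (f \<alpha>)" using \<alpha>(1) f(2) by auto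
    \<comment> \<open>Each maximum is positive because some modulus lies strictly below it, so one
      strict factor makes the whole product inequality strict.\<close>
    fix h assume "h \<in> ?K"
    then obtain \<beta> where "\<beta> \<in> conj_choices" "h = f \<beta>" by auto
    then show "0 \<le> cmod (hom_conj \<alpha> h) \<and> cmod (hom_conj \<alpha> h) \<le> s_max A B E h" "0 < s_max A B E h"
      using s_max_ge[OF f(1) \<alpha>(1)] f(2)[of \<beta>] by (auto intro: le_less_trans[OF norm_ge_zero])
  qed (rule K(1))
  then show False using F(2) F(3)[OF \<alpha>(1)] \<alpha>(2) by simp
qed

end

section \<open>From Borel to Lebesgue measurable functions\<close>

lemma unit_square_lebesgue: "unit_square \<in> sets lebesgue" "unit_square \<inter> space lebesgue \<in> sets lebesgue"
proof -
  have "closed unit_square" by (intro closed_Times closed_atLeastAtMost)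
  then show "unit_square \<in> sets lebesgue" by (intro sets_completionI_sets) (simp add: borel_closed)
  then show "unit_square \<inter> space lebesgue \<in> sets lebesgue" by simp
qed

lemma ex_bdd_borel_AE_eq:
  fixes f :: "real \<times> real \<Rightarrow> complex"
  assumes "f \<in> bdd_meas"
  obtains g where "g \<in> bdd_borel" "AE z in lebesgue_on unit_square. f z = g z"
proof -
  note S = unit_square_lebesgue
  have f: "f \<in> borel_measurable (lebesgue_on unit_square)" using assms by (simp add: bdd_meas_def)
  obtain b where b: "\<And>z. z \<in> unit_square \<Longrightarrow> cmod (f z) \<le> b"
    using assms by (force simp: bdd_meas_def bounded_iff)
  have ext: "(\<lambda>z. indicator unit_square z *\<^sub>R f z) \<in> borel_measurable lebesgue"
    using f by (subst (asm) borel_measurable_restrict_space_iff[OF S(2)])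
  obtain g1 where g1: "g1 \<in> borel_measurable lborel" "AE z in lborel. Re (indicator unit_square z *\<^sub>R f z) = g1 z"
    using completion_ex_borel_measurable_real[OF measurable_compose[OF ext borel_measurable_Re]] by auto
  obtain g2 where g2: "g2 \<in> borel_measurable lborel" "AE z in lborel. Im (indicator unit_square z *\<^sub>R f z) = g2 z"
    using completion_ex_borel_measurable_real[OF measurable_compose[OF ext borel_measurable_Im]] by auto
  define h where "h z = Complex (g1 z) (g2 z)" for z
  have h: "h \<in> borel_measurable borel"
    using g1(1) g2(1) unfolding h_def by (simp add: borel_measurable_complex_iff)
  \<comment> \<open>Off the almost everywhere agreement with \<open>f\<close>, \<open>h\<close> may
    be unbounded. Cutting off at \<open>b\<close> restores boundedness and keeps the points of the
    square where \<open>h\<close> equals \<open>f\<close>.\<close>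
  define g where "g z = (if cmod (h z) \<le> b then h z else 0)" for z
  show thesis
  proof
    have [measurable]: "h \<in> borel_measurable borel" by (rule h)
    have "g \<in> borel_measurable borel" unfolding g_def[abs_def] by measurable
    then show "g \<in> bdd_borel"
      by (rule bdd_borelI[where b = "\<bar>b\<bar>"]) (auto simp: g_def)
    have "AE z in lborel. z \<in> unit_square \<longrightarrow> f z = g z"
      using g1(2) g2(2)
    proof eventually_elim
      case (elim z)
      show ?case
      proof
        assume z: "z \<in> unit_square"
        then have "f z = h z" using elim by (simp add: h_def complex_eq_iff)
        then show "f z = g z" using b[OF z] by (simp add: g_def)
      qed
    qed
    then show "AE z in lebesgue_on unit_square. f z = g z"
      using S by (simp add: AE_restrict_space_iff AE_completion_iff)
  qed
qed

text \<open>Preimages under \<open>f\<close> and \<open>g\<close> agree almost everywhere, hence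
  both are measurable after completion. This covers the integrands of functions that are only
  Lebesgue measurable.\<close>

lemma borel_measurable_completion_cong_AE:
  fixes f g :: "'a \<Rightarrow> 'b :: topological_space"
  assumes "g \<in> borel_measurable M" "AE x in M. f x = g x"
  shows "f \<in> borel_measurable (completion M)"
proof (rule measurableI)
  fix X :: "'b set" assume "X \<in> sets borel"
  then have meas: "g -` X \<inter> space M \<in> sets (completion M)"
    using measurable_sets[OF assms(1)] by (auto intro: sets_completionI_sets)
  have "AE x in completion M. x \<in> g -` X \<inter> space M \<longleftrightarrow> x \<in> f -` X \<inter> space (completion M)"
    using AE_completion[OF assms(2)] by eventually_elim auto
  from completion.in_sets_AE[OF this meas]
  show "f -` X \<inter> space (completion M) \<in> sets (completion M)" by auto
qed simp

context bipartite_graph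
begin

lemma AE_edge_projection:
  assumes "e \<in> E" and ae: "AE z in lebesgue_on unit_square. Q z"
  shows "AE x in cube. Q (x (fst e), x (snd e))"
proof -
  interpret UU: pair_prob_space uniform01 uniform01 ..
  note S = unit_square_lebesgue
  have "AE z in lborel. z \<in> unit_square \<longrightarrow> Q z"
    using ae S by (simp add: AE_restrict_space_iff AE_completion_iff)
  \<comment> \<open>The exceptional set need not be Borel; it is covered by a Borel null set, whose
    complement is measurable in the product space.\<close>
  then obtain N where N: "N \<in> null_sets lborel" "{z. \<not> (z \<in> unit_square \<longrightarrow> Q z)} \<subseteq> N"
    by (auto simp: eventually_ae_filter)
  have "AE z in lborel \<Otimes>\<^sub>M lborel. z \<notin> N"
    unfolding lborel_prod by (rule AE_not_in[OF N(1)])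
  then have "AE x in lborel. AE y in lborel. (x, y) \<notin> N"
    by (rule lborel_pair.AE_pair)
  then have "AE x in uniform01. AE y in uniform01. (x, y) \<notin> N"
    by (simp add: AE_restrict_space_iff eventually_mono)
  moreover have "{z \<in> space (uniform01 \<Otimes>\<^sub>M uniform01). z \<notin> N} \<in> sets (uniform01 \<Otimes>\<^sub>M uniform01)"
    using measurable_sets[OF uniform01_pair_borel, of "- N"] N(1)
    by (auto simp: null_sets_def Int_def vimage_def conj_commute)
  ultimately have "AE z in uniform01 \<Otimes>\<^sub>M uniform01. z \<notin> N"
    by (intro UU.AE_pair_measure)
  then have "AE z in distr cube (uniform01 \<Otimes>\<^sub>M uniform01) (\<lambda>x. (x (fst e), x (snd e))). z \<notin> N"
    by (simp only: distr_edge_projection[OF assms(1)])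
  from AE_distrD[OF edge_projection_measurable[OF assms(1)] this]
  show ?thesis
  proof (rule AE_mp[OF _ AE_I2], intro impI)
    fix x assume x: "x \<in> space cube" "(x (fst e), x (snd e)) \<notin> N"
    have "x (fst e) \<in> {0..1}" "x (snd e) \<in> {0..1}"
      using x(1) edge_verts[OF assms(1)] by (auto simp: space_PiM PiE_iff simp del: atLeastAtMost_iff)
    with N(2) x(2) show "Q (x (fst e), x (snd e))" by blast
  qed
qed

text \<open>As there are finitely many edges, almost every point of the cube makes all edge factors
  agree at once.\<close>

lemma t_hom_conj_cong_AE:
  assumes g: "g \<in> bdd_borel" and \<alpha>: "\<alpha> \<in> conj_choices" and ae: "AE z in lebesgue_on unit_square. f z = g z"
  shows "t_hom_conj A B E \<alpha> f = t_hom_conj A B E \<alpha> g"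
proof -
  let ?F = "\<lambda>f x. \<Prod>e\<in>E. twist (\<alpha> e) f (x (fst e), x (snd e))"
  have "AE x in cube. \<forall>e\<in>E. f (x (fst e), x (snd e)) = g (x (fst e), x (snd e))"
    using AE_edge_projection[OF _ ae] by (intro AE_finite_allI finite_edges)
  then have eq: "AE x in cube. ?F f x = ?F g x"
    by eventually_elim (auto simp: twist_def intro!: prod.cong)
  have meas: "?F g \<in> borel_measurable cube"
    by (intro measurable_integrand bdd_borelD[OF bdd_borel_twist] conj_choicesD \<alpha> g)
  have "integral\<^sup>L (completion cube) (?F f) = integral\<^sup>L (completion cube) (?F g)"
    by (intro integral_cong_AE borel_measurable_completion_cong_AE[OF meas eq] measurable_completion meas
        AE_completion eq)
  then show ?thesis
    by (simp add: t_hom_conj_def cube_measure_def twist_def split_def)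
qed

lemma s_max_cong_AE:
  assumes g: "g \<in> bdd_borel" and ae: "AE z in lebesgue_on unit_square. f z = g z"
  shows "s_max A B E f = s_max A B E g"
  unfolding s_max_def using t_hom_conj_cong_AE[OF g _ ae] by (simp cong: image_cong_simp)

lemma t_hom_conj_of_real:
  assumes "\<alpha> \<in> conj_choices"
  shows "t_hom_conj A B E \<alpha> (\<lambda>z. complex_of_real (f z)) = complex_of_real (t_hom A B E f)"
proof -
  have "(\<Prod>e\<in>E. complex_of_real (y e) ^ \<alpha> e * cnj (complex_of_real (y e)) ^ (1 - \<alpha> e)) = complex_of_real (\<Prod>e\<in>E. y e)" for y
    unfolding of_real_prod
  proof (rule prod.cong)
    fix e assume "e \<in> E"
    from conj_choicesD[OF assms this]
    show "complex_of_real (y e) ^ \<alpha> e * cnj (complex_of_real (y e)) ^ (1 - \<alpha> e) = complex_of_real (y e)" by auto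
  qed simp
  then show ?thesis
    unfolding t_hom_conj_def t_hom_def split_def prod.collapse by (simp only: integral_complex_of_real)
qed

lemma s_max_of_real: "s_max A B E (\<lambda>z. complex_of_real (f z)) = \<bar>t_hom A B E f\<bar>"
  unfolding s_max_def using conj_choices_nonempty
  by (simp add: t_hom_conj_of_real image_constant_conv cong: image_cong_simp)

lemma bdd_meas_of_real: "f \<in> bdd_meas \<Longrightarrow> (\<lambda>z. complex_of_real (f z)) \<in> bdd_meas"
proof -
  assume f: "f \<in> bdd_meas"
  have "complex_of_real \<in> borel_measurable borel"
    by (intro borel_measurable_continuous_onI continuous_on_of_real_id)
  then have "(\<lambda>z. complex_of_real (f z)) \<in> borel_measurable (lebesgue_on unit_square)"
    by (rule measurable_compose[rotated]) (use f in \<open>simp add: bdd_meas_def\<close>)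
  with f show ?thesis by (simp add: bdd_meas_def bounded_iff)
qed

text \<open>Restriction of a norm to the real functions. It serves both converse directions, with
  \<open>M\<close> either \<open>s_max\<close> or the modulus of one
  \<open>t_hom_conj\<close>.\<close>

lemma real_norming_if_is_norm:
  assumes N: "is_norm (\<lambda>f. edge_root (M f))"
    and M: "\<And>f. M (\<lambda>z. complex_of_real (f z)) = \<bar>t_hom A B E f\<bar>"
  shows "real_norming A B E"
proof -
  note scale = is_seminorm_scale[OF is_norm_is_seminorm[OF N]]
  note tri = is_seminorm_triangle[OF is_norm_is_seminorm[OF N]]
  note eq0 = is_norm_eq_0D[OF N]
  show ?thesis
    unfolding real_norming_def is_norm_def is_seminorm_def
  proof (intro conjI ballI allI impI)
    fix f g :: "real \<times> real \<Rightarrow> real" and c :: real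
    assume f: "f \<in> bdd_meas"
    show "edge_root \<bar>t_hom A B E (\<lambda>z. c * f z)\<bar> = norm c * edge_root \<bar>t_hom A B E f\<bar>"
      using scale[OF bdd_meas_of_real[OF f], of "of_real c"]
      unfolding of_real_mult[symmetric] M by simp
    show "edge_root \<bar>t_hom A B E (\<lambda>z. f z + g z)\<bar> \<le> edge_root \<bar>t_hom A B E f\<bar> + edge_root \<bar>t_hom A B E g\<bar>"
      if g: "g \<in> bdd_meas"
      using tri[OF bdd_meas_of_real[OF f] bdd_meas_of_real[OF g]]
      unfolding of_real_add[symmetric] M .
    show "AE z in lebesgue_on unit_square. f z = 0" if "edge_root \<bar>t_hom A B E f\<bar> = 0"
      using eq0[OF bdd_meas_of_real[OF f]] that unfolding M by simp
  qed simp
qed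

end

section \<open>Definiteness and passage to all bounded measurable functions\<close>

context paired_graph
begin

lemma s_max_eq_0_imp_AE:
  assumes norming: "real_norming A B E" and f: "f \<in> bdd_borel" and 0: "s_max A B E f = 0"
  shows "AE z in lebesgue_on unit_square. f z = 0"
proof -
  have re: "AE z in lebesgue_on unit_square. 2 * Re (h z) = 0" if h: "h \<in> bdd_borel" "s_max A B E h = 0" for h
  proof -
    have "(\<lambda>z. 2 * Re (h z)) \<in> bdd_meas"
      using bdd_borel_Re_meas[OF bdd_borel_mult[OF bdd_borel_const[of 2] h(1)]] by simp
    then show ?thesis
      by (rule is_norm_eq_0D[OF norming[unfolded real_norming_def]])
        (simp add: t_hom_double_Re_eq_0[OF norming h])
  qed
  \<comment> \<open>The real part of \<open>- \<i> * f z\<close> is the imaginary part of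
    \<open>f z\<close>, and scaling preserves the vanishing of \<open>s_max\<close>.\<close>
  have "AE z in lebesgue_on unit_square. 2 * Re (- \<i> * f z) = 0"
    using s_max_scale[OF f, of "- \<i>"] 0 by (intro re bdd_borel_mult bdd_borel_const f) simp
  with re[OF f 0] show ?thesis
    by eventually_elim (simp add: complex_eq_iff)
qed

text \<open>The norm properties hold for Borel functions, and passing to Borel representatives
  changes none of the values of \<open>s_max\<close>.\<close>

lemma is_norm_s_max:
  assumes norming: "real_norming A B E"
  shows "is_norm (\<lambda>f. edge_root (s_max A B E f))"
  unfolding is_norm_def is_seminorm_def
proof (intro conjI ballI allI impI)
  fix f :: "real \<times> real \<Rightarrow> complex" assume "f \<in> bdd_meas"
  then obtain f' where f': "f' \<in> bdd_borel" "AE z in lebesgue_on unit_square. f z = f' z"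
    by (rule ex_bdd_borel_AE_eq)
  note sf = s_max_cong_AE[OF f']
  show "0 \<le> edge_root (s_max A B E f)" by simp
  show "edge_root (s_max A B E (\<lambda>z. c * f z)) = norm c * edge_root (s_max A B E f)" for c
  proof -
    have "s_max A B E (\<lambda>z. c * f z) = s_max A B E (\<lambda>z. c * f' z)"
      using f' by (intro s_max_cong_AE bdd_borel_mult bdd_borel_const) auto
    then show ?thesis
      using s_max_nonneg[OF f'(1)] by (simp add: sf s_max_scale[OF f'(1)] powr_mult power_edge_root)
  qed
  show "edge_root (s_max A B E (\<lambda>z. f z + g z)) \<le> edge_root (s_max A B E f) + edge_root (s_max A B E g)"
    if g: "g \<in> bdd_meas" for g
  proof -
    obtain g' where g': "g' \<in> bdd_borel" "AE z in lebesgue_on unit_square. g z = g' z"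
      using g by (rule ex_bdd_borel_AE_eq)
    have "AE z in lebesgue_on unit_square. f z + g z = f' z + g' z"
      using f'(2) g'(2) by eventually_elim simp
    then have "s_max A B E (\<lambda>z. f z + g z) = s_max A B E (\<lambda>z. f' z + g' z)"
      by (intro s_max_cong_AE bdd_borel_add f' g')
    then show ?thesis
      using s_max_triangle[OF norming f'(1) g'(1)] by (simp add: sf s_max_cong_AE[OF g'])
  qed
  show "AE z in lebesgue_on unit_square. f z = 0" if "edge_root (s_max A B E f) = 0"
  proof -
    have "AE z in lebesgue_on unit_square. f' z = 0"
      using s_max_eq_0_imp_AE[OF norming f'(1)] that by (simp add: sf)
    with f'(2) show ?thesis by eventually_elim simp
  qed
qed

lemma complex_norming_if_real_norming:
  assumes norming: "real_norming A B E"
  shows "complex_norming A B E"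
proof -
  obtain \<alpha> where \<alpha>: "\<alpha> \<in> conj_choices" "\<And>f. f \<in> bdd_borel \<Longrightarrow> cmod (hom_conj \<alpha> f) = s_max A B E f"
    using ex_conj_choice_s_max[OF norming] by blast
  have eq: "cmod (t_hom_conj A B E \<alpha> f) = s_max A B E f" if f: "f \<in> bdd_meas" for f
  proof -
    obtain f' where f': "f' \<in> bdd_borel" "AE z in lebesgue_on unit_square. f z = f' z"
      using f by (rule ex_bdd_borel_AE_eq)
    then show ?thesis
      by (simp add: t_hom_conj_cong_AE[OF f'(1) \<alpha>(1) f'(2)] s_max_cong_AE[OF f']
          t_hom_conj_eq[OF \<alpha>(1) f'(1)] \<alpha>(2)[OF f'(1)])
  qed
  have add: "(\<lambda>z. f z + g z) \<in> bdd_meas" if "f \<in> bdd_meas" "g \<in> bdd_meas" for f g :: "real \<times> real \<Rightarrow> complex"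
    using that by (auto simp: bdd_meas_def bounded_plus_comp)
  have scale: "(\<lambda>z. c * f z) \<in> bdd_meas" if "f \<in> bdd_meas" for c and f :: "real \<times> real \<Rightarrow> complex"
  proof -
    from that obtain b where "\<And>z. z \<in> unit_square \<Longrightarrow> cmod (f z) \<le> b"
      by (force simp: bdd_meas_def bounded_iff)
    then have "bounded ((\<lambda>z. c * f z) ` unit_square)"
      by (intro boundedI[where B = "cmod c * b"]) (auto simp: norm_mult intro!: mult_left_mono)
    with that show ?thesis by (auto simp: bdd_meas_def)
  qed
  \<comment> \<open>\<open>is_norm\<close> evaluates the functional on \<open>bdd_meas\<close> only,
    because that set is closed under sums and scalar multiples; agreement with \<open>s_max\<close>
    there suffices.\<close>
  have "is_norm (\<lambda>f. edge_root (cmod (t_hom_conj A B E \<alpha> f)))"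
    using is_norm_s_max[OF norming] unfolding is_norm_def is_seminorm_def
    by (simp add: eq add scale)
  with \<alpha>(1) show ?thesis unfolding complex_norming_def by blast
qed

end

theorem theorem5p2:
  fixes A B :: "'v set" and E :: "('v \<times> 'v) set"
  assumes "bipartite_graph A B E"
  shows "(real_norming A B E \<longleftrightarrow> is_norm (\<lambda>f. s_max A B E f powr (1 / real (card E)))) \<and>
         (is_norm (\<lambda>f. s_max A B E f powr (1 / real (card E))) \<longleftrightarrow> complex_norming A B E)"
proof -
  interpret bipartite_graph A B E by fact
  obtain p q where pq: "p \<in> borel_measurable borel" "q \<in> borel_measurable borel"
    "range p \<subseteq> {0..1}" "range q \<subseteq> {0..1}"
    "distr uniform01 (uniform01 \<Otimes>\<^sub>M uniform01) (\<lambda>x. (p x, q x)) = uniform01 \<Otimes>\<^sub>M uniform01"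
    by (rule ex_measure_preserving_pair)
  have "p x \<in> {0..1}" "q x \<in> {0..1}" for x using pq(3,4) by blast+
  then interpret paired_graph A B E p q
    by (intro paired_graph.intro paired_graph_axioms.intro assms pq)
  have "real_norming A B E" if "is_norm (\<lambda>f. s_max A B E f powr (1 / real (card E)))"
    using real_norming_if_is_norm[OF that s_max_of_real] .
  moreover have "real_norming A B E" if "complex_norming A B E"
  proof -
    obtain \<alpha> where "\<alpha> \<in> conj_choices" "is_norm (\<lambda>f. cmod (t_hom_conj A B E \<alpha> f) powr (1 / real (card E)))"
      using \<open>complex_norming A B E\<close> unfolding complex_norming_def by blast
    then show ?thesis
      using real_norming_if_is_norm[of "\<lambda>f. cmod (t_hom_conj A B E \<alpha> f)"] by (simp add: t_hom_conj_of_real)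
  qed
  ultimately show ?thesis
    using is_norm_s_max complex_norming_if_real_norming by blast
qed

end
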